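(* Let $P$ be a countable poset with no infinite antichain which is vacillating. Then $P$ contains a spine, i.e. there is a chain $C\subseteq P$ and a partition of $P$ into antichains $(A_i : i\in I)$ such that $C$ meets every $A_i$.
   Context: A chain $C$ in a poset $P$ is contiguous if there is no $x\in P\setminus C$ and $y,z\in C$ with $y<x<z$ and $C\cup\{x\}$ a chain. For a total order $I$ and posets $(C_i : i\in I)$, the linear sum $\bigoplus_{i\in I}C_i$ is the disjoint union in which all elements of $C_j$ are greater than all elements of $C_i$ whenever $j>i$ in $I$ (and each $C_i$ keeps its own order). $C^*$ denotes the reverse order of $C$. A poset is co-wellfounded if it has no infinite strictly increasing sequence. $\omega$ denotes the order type of the natural numbers. A poset $P$ is vacillating if there is no contiguous chain $C$ of $P$ such that $C$ or $C^*$ can be written as $\bigoplus_{i\in\omega}C_i$ with each $C_i$ infinite and co-wellfounded. A spine of $P$ is a chain $C$ for which there is a partition of $P$ into antichains each of which meets $C$. *)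

theory Defs
  imports "HOL-Library.Countable_Set" "HOL-Library.Disjoint_Sets"
begin

text \<open>
  A poset is a carrier \<open>P\<close> with a reflexive order relation \<open>r\<close> such that \<open>partial_order_on P r\<close>.
  A subset \<open>C\<close> of \<open>P\<close> is a poset under the restriction of \<open>r\<close>, and its reverse
  is \<open>C\<close> under \<open>r\<inverse>\<close>.
\<close>

definition poset_chain :: "'a set \<Rightarrow> 'a rel \<Rightarrow> 'a set \<Rightarrow> bool" where
  "poset_chain P r C \<longleftrightarrow> C \<subseteq> P \<and> total_on C r"

definition poset_antichain :: "'a set \<Rightarrow> 'a rel \<Rightarrow> 'a set \<Rightarrow> bool" where
  "poset_antichain P r A \<longleftrightarrow> A \<subseteq> P \<and> (\<forall>x\<in>A. \<forall>y\<in>A. x \<noteq> y \<longrightarrow> (x, y) \<notin> r)"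

definition contiguous_chain :: "'a set \<Rightarrow> 'a rel \<Rightarrow> 'a set \<Rightarrow> bool" where
  "contiguous_chain P r C \<longleftrightarrow> poset_chain P r C \<and>
     \<not> (\<exists>x\<in>P - C. \<exists>y\<in>C. \<exists>z\<in>C. (y, x) \<in> r - Id \<and> (x, z) \<in> r - Id \<and>
          poset_chain P r (C \<union> {x}))"

text \<open>
  The linear sum is taken internally: \<open>C\<close> is the disjoint union of its subsets \<open>S i\<close>, and the
  order of \<open>C\<close> is exactly that of the sum of the posets \<open>S i\<close> over the total order \<open>I\<close>.
\<close>

definition is_linear_sum :: "'a set \<Rightarrow> 'a rel \<Rightarrow> 'i::linorder set \<Rightarrow> ('i \<Rightarrow> 'a set) \<Rightarrow> bool" where
  "is_linear_sum C r I S \<longleftrightarrow>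
     disjoint_family_on S I \<and> C = (\<Union>i\<in>I. S i) \<and>
     Restr r C = (\<Union>i\<in>I. Restr r (S i)) \<union> (\<Union>i\<in>I. \<Union>j\<in>{j\<in>I. i < j}. S i \<times> S j)"

definition co_wellfounded :: "'a set \<Rightarrow> 'a rel \<Rightarrow> bool" where
  "co_wellfounded C r \<longleftrightarrow>
     \<not> (\<exists>f :: nat \<Rightarrow> 'a. range f \<subseteq> C \<and> (\<forall>m n. m < n \<longrightarrow> (f m, f n) \<in> r - Id))"

definition omega_sum_of_infinite_co_wellfounded :: "'a set \<Rightarrow> 'a rel \<Rightarrow> bool" where
  "omega_sum_of_infinite_co_wellfounded C r \<longleftrightarrow>
     (\<exists>S :: nat \<Rightarrow> 'a set. is_linear_sum C r UNIV S \<and>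
        (\<forall>i. infinite (S i) \<and> co_wellfounded (S i) r))"

definition vacillating :: "'a set \<Rightarrow> 'a rel \<Rightarrow> bool" where
  "vacillating P r \<longleftrightarrow>
     \<not> (\<exists>C. contiguous_chain P r C \<and>
          (omega_sum_of_infinite_co_wellfounded C r \<or>
           omega_sum_of_infinite_co_wellfounded C (r\<inverse>)))"

definition spine :: "'a set \<Rightarrow> 'a rel \<Rightarrow> 'a set \<Rightarrow> bool" where
  "spine P r C \<longleftrightarrow> poset_chain P r C \<and>
     (\<exists>\<A>. partition_on P \<A> \<and> (\<forall>A\<in>\<A>. poset_antichain P r A \<and> A \<inter> C \<noteq> {}))"

end

(*
  Cut out of P a linearly ordered family of disjoint "regions" Q, each of which lies entirely below
  or above the next, such that in every Q each infinite increasing sequence is cofinal and each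
  infinite decreasing sequence is coinitial.  Then every point of Q is incomparable to only
  finitely many points of Q, so Q has a spine by compactness from the finite case.  A maximal
  family of regions, suitably closed and without adjacent finite ends, leaves outside only points
  that are incomparable to infinitely many classes; as P is countable, these points can be given
  distinct classes greedily.

  A maximal family exists by Zorn's lemma, and it is maximal in the right sense because every
  nonempty convex set T contains a nonempty family.  If T is scattered and infinite, it has an
  infinite well-founded beginning, or an infinite co-well-founded end, or a "discrete pair": a
  decreasing sequence below an increasing one with all intervals between them finite.  Only this
  last case uses vacillation, in the form that there is no sequence x_0 < x_1 < ... with all
  intervals (x_i, x_(i+1)) infinite and co-well-founded, and no dual one.  Among the increasing
  sequences in a set with finite intervals there is one with minimal down-closure, because there is
  no infinite antichain; this yields a region.  If T is not scattered, it contains a densely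
  ordered set of pairwise separated scattered convex subsets.
*)

theory Submission
  imports Defs "HOL-Library.Ramsey"
begin

section \<open>Sequences and intervals\<close>

text \<open>Two points outside the regions may be comparable, so a class of the spine can safely
  take in at most one of them. Hence each such point needs infinitely many open classes, and not
  merely one. The spine itself is fixed by the regions alone, because outside points only join
  existing classes. The obstacle is an outside point \<open>p\<close> beside ends that carry no
  infinite sequence: an infinite end of a region supplies infinitely many classes, a finite end may
  supply none. Such a \<open>p\<close> is either beside a single region, which then has to absorb
  it, or beside two neighbouring regions, between which another region has to appear. These are the
  two closure conditions on a family. They refer to the whole family, so the work in enlarging a
  family is to show that old and new regions do not spoil them for each other. Vacillation is turned
  into a statement on intervals by filling each interval of a forbidden sequence with a maximal
  chain. All notions are self-dual up to exchanging ascending and descending, so one-sided arguments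
  are transferred by interpreting the locale for the reversed order.\<close>

definition asc :: "('a \<Rightarrow> 'a \<Rightarrow> bool) \<Rightarrow> 'a set \<Rightarrow> (nat \<Rightarrow> 'a) \<Rightarrow> bool" where
  "asc lt X f \<longleftrightarrow> (\<forall>i. f i \<in> X \<and> lt (f i) (f (Suc i)))"

definition noasc :: "('a \<Rightarrow> 'a \<Rightarrow> bool) \<Rightarrow> 'a set \<Rightarrow> bool" where
  "noasc lt X \<longleftrightarrow> (\<nexists>f. asc lt X f)"

definition oi :: "('a \<Rightarrow> 'a \<Rightarrow> bool) \<Rightarrow> 'a \<Rightarrow> 'a \<Rightarrow> 'a set" where
  "oi lt x y = {z. lt x z \<and> lt z y}"

definition ordconvex :: "('a \<Rightarrow> 'a \<Rightarrow> bool) \<Rightarrow> 'a set \<Rightarrow> bool" where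
  "ordconvex lt X \<longleftrightarrow> (\<forall>x\<in>X. \<forall>y\<in>X. oi lt x y \<subseteq> X)"

definition no_bad_seq :: "('a \<Rightarrow> 'a \<Rightarrow> bool) \<Rightarrow> bool" where
  "no_bad_seq lt \<longleftrightarrow> (\<nexists>f :: nat \<Rightarrow> 'a. \<forall>i. lt (f i) (f (Suc i)) \<and>
     infinite (oi lt (f i) (f (Suc i))) \<and> noasc lt (oi lt (f i) (f (Suc i))))"

definition star :: "('a \<Rightarrow> 'a \<Rightarrow> bool) \<Rightarrow> 'a set \<Rightarrow> bool" where
  "star lt Q \<longleftrightarrow> (\<forall>z. asc lt Q z \<longrightarrow> (\<forall>x\<in>Q. \<exists>i. lt x (z i))) \<and>
     (\<forall>z. asc lt\<inverse>\<inverse> Q z \<longrightarrow> (\<forall>x\<in>Q. \<exists>i. lt (z i) x))"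

definition below :: "('a \<Rightarrow> 'a \<Rightarrow> bool) \<Rightarrow> 'a set \<Rightarrow> 'a set \<Rightarrow> bool" where
  "below lt A B \<longleftrightarrow> (\<forall>a\<in>A. \<forall>b\<in>B. lt a b)"

lemma oi_conversep [simp]: "oi lt\<inverse>\<inverse> x y = oi lt y x"
  by (auto simp: oi_def)

lemma ordconvex_conversep [simp]: "ordconvex lt\<inverse>\<inverse> X = ordconvex lt X"
  by (auto simp: ordconvex_def)

lemma star_conversep [simp]: "star lt\<inverse>\<inverse> Q = star lt Q"
  by (auto simp: star_def)

lemma below_conversep [simp]: "below lt\<inverse>\<inverse> A B = below lt B A"
  by (auto simp: below_def)

lemma noasc_subset: "noasc lt Y \<Longrightarrow> X \<subseteq> Y \<Longrightarrow> noasc lt X"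
  unfolding noasc_def asc_def by blast

lemma asc_subset: "asc lt X f \<Longrightarrow> X \<subseteq> Y \<Longrightarrow> asc lt Y f"
  unfolding asc_def by blast

lemma asc_shift: "asc lt X f \<Longrightarrow> asc lt X (\<lambda>i. f (i + k))"
  unfolding asc_def by simp

lemma ordconvexD: "ordconvex lt X \<Longrightarrow> x \<in> X \<Longrightarrow> y \<in> X \<Longrightarrow> lt x z \<Longrightarrow> lt z y \<Longrightarrow> z \<in> X"
  unfolding ordconvex_def oi_def by blast

text \<open>Recursive choice in which the past matters only through the finite set of values chosen
  so far. It serves to build an infinite antichain and to hand out distinct classes.\<close>

lemma finite_history_choice:
  fixes R :: "nat \<Rightarrow> 'a set \<Rightarrow> 'a \<Rightarrow> bool"
  assumes "\<And>n F. finite F \<Longrightarrow> \<exists>x. R n F x"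
  shows "\<exists>f. \<forall>n. R n (f ` {..<n}) (f n)"
proof (rule dependent_wellorder_choice)
  fix r and f g :: "nat \<Rightarrow> 'a" and x :: nat
  assume "\<And>y. y < x \<Longrightarrow> f y = g y"
  then have "f ` {..<x} = g ` {..<x}"
    by (auto intro!: image_cong)
  then show "R x (f ` {..<x}) r = R x (g ` {..<x}) r"
    by simp
qed (simp add: assms)

locale fac_order =
  fixes lt :: "'a \<Rightarrow> 'a \<Rightarrow> bool" (infix "\<sqsubset>" 50) and P :: "'a set"
  assumes irrefl: "\<not> x \<sqsubset> x"
    and trans: "x \<sqsubset> y \<Longrightarrow> y \<sqsubset> z \<Longrightarrow> x \<sqsubset> z"
    and field: "x \<sqsubset> y \<Longrightarrow> x \<in> P \<and> y \<in> P"
    and fac: "A \<subseteq> P \<Longrightarrow> infinite A \<Longrightarrow> \<exists>x\<in>A. \<exists>y\<in>A. x \<sqsubset> y"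
    and countable_carrier: "countable P"
begin

lemma dual: "fac_order lt\<inverse>\<inverse> P"
proof
  show "\<exists>x\<in>A. \<exists>y\<in>A. lt\<inverse>\<inverse> x y" if "A \<subseteq> P" "infinite A" for A
    using fac[OF that] by auto
qed (use irrefl trans field countable_carrier in auto)

lemma asym: "x \<sqsubset> y \<Longrightarrow> \<not> y \<sqsubset> x"
  using irrefl trans by blast

lemma asc_less:
  assumes "asc lt X f" "i < j"
  shows "f i \<sqsubset> f j"
  using assms(2)
proof (induction j)
  case (Suc j)
  have "f j \<sqsubset> f (Suc j)" using assms(1) by (simp add: asc_def)
  then show ?case using Suc trans by (metis less_antisym)
qed simp

lemma asc_infinite: "asc lt X f \<Longrightarrow> infinite X"
proof -
  assume f: "asc lt X f"
  have "inj f"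
    by (rule injI) (metis asc_less[OF f] irrefl linorder_neqE_nat)
  moreover have "range f \<subseteq> X"
    using f by (auto simp: asc_def)
  ultimately show ?thesis
    by (meson finite_subset range_inj_infinite)
qed

lemma oi_mono: "x' = x \<or> x' \<sqsubset> x \<Longrightarrow> y = y' \<or> y \<sqsubset> y' \<Longrightarrow> oi lt x y \<subseteq> oi lt x' y'"
  unfolding oi_def using trans by blast

text \<open>Ramsey for pairs with three colours (ascending, descending, incomparable); a homogeneous
  set of the third colour would be an infinite antichain.\<close>

lemma infinite_asc_or_desc:
  assumes "X \<subseteq> P" "infinite X"
  shows "\<exists>f. asc lt X f \<or> asc lt\<inverse>\<inverse> X f"
proof -
  obtain e :: "nat \<Rightarrow> 'a" where e: "inj e" "range e \<subseteq> X"
    using assms(2) infinite_countable_subset by blast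
  \<comment> \<open>Ramsey colours unordered pairs; \<open>Min\<close> and \<open>Max\<close>
    recover the order of the two indices.\<close>
  define col :: "nat set \<Rightarrow> nat" where
    "col S = (if e (Min S) \<sqsubset> e (Max S) then 0 else if e (Max S) \<sqsubset> e (Min S) then 1 else 2)" for S
  have "\<forall>x\<in>UNIV. \<forall>y\<in>UNIV. x \<noteq> y \<longrightarrow> col {x, y} < 3"
    by (simp add: col_def)
  from Ramsey2[OF infinite_UNIV_nat this] obtain Y t where Y: "infinite Y" "t < 3"
    and t: "\<And>x y. x \<in> Y \<Longrightarrow> y \<in> Y \<Longrightarrow> x \<noteq> y \<Longrightarrow> col {x, y} = t"
    by auto
  have col: "col {i, j} = (if e i \<sqsubset> e j then 0 else if e j \<sqsubset> e i then 1 else 2)" if "i < j" for i j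
    using that by (simp add: col_def min_def max_def)
  define s where "s = enumerate Y"
  have s: "s i \<in> Y" "s i < s (Suc i)" for i
    using Y(1) by (auto simp: s_def enumerate_in_set)
  have s_t: "col {s i, s (Suc i)} = t" for i
    using t s by (metis less_irrefl)
  consider "t = 0" | "t = 1" | "t = 2"
    using Y(2) by linarith
  then show ?thesis
  proof cases
    case 1
    then have "e (s i) \<sqsubset> e (s (Suc i))" for i
      using s_t[of i] col[OF s(2), of i] by (metis numeral_2_eq_2 zero_neq_one nat.distinct(1))
    then have "asc lt X (\<lambda>i. e (s i))"
      using e(2) by (auto simp: asc_def)
    then show ?thesis by (intro exI disjI1)
  next
    case 2
    then have "e (s (Suc i)) \<sqsubset> e (s i)" for i
      using s_t[of i] col[OF s(2), of i] by (metis numeral_eq_one_iff semiring_norm(85) zero_neq_one)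
    then have "asc lt\<inverse>\<inverse> X (\<lambda>i. e (s i))"
      using e(2) by (auto simp: asc_def)
    then show ?thesis by (intro exI disjI2)
  next
    case 3
    have "infinite (e ` Y)"
      using Y(1) e(1) by (metis finite_imageD inj_on_subset subset_UNIV)
    then obtain i j where ij: "i \<in> Y" "j \<in> Y" "e i \<sqsubset> e j"
      using fac[of "e ` Y"] e(2) assms(1) by blast
    then have "i \<noteq> j" using irrefl by auto
    then have "col {i, j} = 2" using t ij 3 by auto
    moreover have "col {i, j} = 0 \<or> col {i, j} = 1"
    proof (cases "i < j")
      case True
      then show ?thesis using col[OF True] ij(3) by simp
    next
      case False
      then have "j < i" using \<open>i \<noteq> j\<close> by simp
      from col[OF this] have "col {j, i} = 1" using ij(3) asym[OF ij(3)] by simp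
      then show ?thesis by (simp add: insert_commute)
    qed
    ultimately show ?thesis by simp
  qed
qed

lemma nodesc_minimal:
  assumes "noasc lt\<inverse>\<inverse> X" "x \<in> X"
  shows "\<exists>m\<in>X. \<forall>y\<in>X. \<not> y \<sqsubset> m"
proof (rule ccontr)
  assume "\<not> ?thesis"
  then have "\<exists>f. \<forall>n. f n \<in> X \<and> f (Suc n) \<sqsubset> f n"
    using dependent_nat_choice[of "\<lambda>n y. y \<in> X" "\<lambda>n y z. z \<sqsubset> y"] assms(2) by blast
  then show False using assms(1) by (auto simp: noasc_def asc_def)
qed

lemma finite_noasc: "finite X \<Longrightarrow> noasc lt X"
  using asc_infinite by (auto simp: noasc_def)

lemma finite_minimal:
  assumes "finite X" "x \<in> X"
  shows "\<exists>m\<in>X. \<forall>y\<in>X. \<not> y \<sqsubset> m"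
proof -
  interpret d: fac_order "lt\<inverse>\<inverse>" P by (rule dual)
  show ?thesis
    using nodesc_minimal[OF d.finite_noasc] assms by blast
qed

section \<open>Spines of regions\<close>

text \<open>An infinite set of points incomparable to \<open>x\<close> would contain a monotone
  sequence, which \<open>star\<close> makes cofinal or coinitial, so that some term is comparable to
  \<open>x\<close>. This finiteness is what makes compactness applicable to a region.\<close>

lemma star_finite_incomparable:
  assumes "star lt Q" "Q \<subseteq> P" "x \<in> Q"
  shows "finite {y \<in> Q. \<not> x \<sqsubset> y \<and> \<not> y \<sqsubset> x}" (is "finite ?I")
proof (rule ccontr)
  assume "infinite ?I"
  then obtain f where f: "asc lt ?I f \<or> asc lt\<inverse>\<inverse> ?I f"
    using infinite_asc_or_desc[of ?I] assms(2) by auto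
  have "f i \<in> ?I" for i
    using f by (auto simp: asc_def)
  moreover have "asc lt Q f \<or> asc lt\<inverse>\<inverse> Q f"
    using f asc_subset[of _ ?I f Q] by blast
  then have "\<exists>i. x \<sqsubset> f i \<or> f i \<sqsubset> x"
    using assms(1,3) unfolding star_def by blast
  ultimately show False by blast
qed

end

text \<open>
  A spine is encoded as a retraction onto it whose fibres are the antichains.
\<close>

definition spine_map :: "('a \<Rightarrow> 'a \<Rightarrow> bool) \<Rightarrow> 'a set \<Rightarrow> ('a \<Rightarrow> 'a) \<Rightarrow> bool" where
  "spine_map lt X f \<longleftrightarrow> (\<forall>x\<in>X. f x \<in> X \<and> f (f x) = f x) \<and>
     (\<forall>x\<in>X. \<forall>y\<in>X. (f x = f y \<longrightarrow> \<not> lt x y) \<and> (f x = f y \<or> lt (f x) (f y) \<or> lt (f y) (f x)))"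

context fac_order
begin

text \<open>Mirsky's argument: the minimal elements form one antichain, and the chain obtained for
  the rest is prolonged downwards by one of them.\<close>

lemma finite_spine_map:
  assumes "finite X"
  shows "\<exists>f. spine_map lt X f"
  using assms
proof (induction "card X" arbitrary: X rule: less_induct)
  case less
  define M where "M = {m \<in> X. \<forall>y\<in>X. \<not> y \<sqsubset> m}"

  show ?case
  proof (cases "X = {}")
    case True
    then show ?thesis by (intro exI[of _ id]) (simp add: spine_map_def)
  next
    case False
    have below_M: "\<exists>m\<in>M. m = x \<or> m \<sqsubset> x" if "x \<in> X" for x
    proof -
      let ?B = "{y \<in> X. y = x \<or> y \<sqsubset> x}"
      have "finite ?B" "x \<in> ?B" using less.prems that by auto
      then obtain m where m: "m \<in> ?B" "\<forall>y\<in>?B. \<not> y \<sqsubset> m"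
        using finite_minimal by blast
      then have "\<not> y \<sqsubset> m" if "y \<in> X" for y
        using that irrefl trans by blast
      then show ?thesis using m(1) by (auto simp: M_def)
    qed
    then have "M \<noteq> {}" using False by blast
    then have "card (X - M) < card X"
      using less.prems by (intro psubset_card_mono) (auto simp: M_def)
    then obtain f where f: "spine_map lt (X - M) f"
      using less by fastforce
    \<comment> \<open>It suffices to go below the least element \<open>c\<close> of the chain found
      for \<open>X - M\<close>: as \<open>c\<close> is not minimal in \<open>X\<close>, some minimal
      element lies strictly under it.\<close>
    have "\<exists>m\<in>M. \<forall>c\<in>f ` (X - M). m \<sqsubset> c"
    proof (cases "X - M = {}")
      case True
      then show ?thesis using \<open>M \<noteq> {}\<close> by auto
    next
      case F: False
      obtain c where c: "c \<in> f ` (X - M)" "\<forall>y\<in>f ` (X - M). \<not> y \<sqsubset> c"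
        using finite_minimal[of "f ` (X - M)"] F less.prems by blast
      have cX: "c \<in> X - M" using c(1) f by (auto simp: spine_map_def)
      then obtain m where m: "m \<in> M" "m \<sqsubset> c" using below_M by blast
      have "c = y \<or> c \<sqsubset> y" if "y \<in> f ` (X - M)" for y
        using that c f unfolding spine_map_def by (smt (verit) image_iff)
      then show ?thesis using m trans by blast
    qed
    then obtain m where m: "m \<in> M" "\<And>c. c \<in> f ` (X - M) \<Longrightarrow> m \<sqsubset> c" by blast
    define g where "g x = (if x \<in> M then m else f x)" for x
    have gM: "g x = m" if "x \<in> M" for x using that by (simp add: g_def)
    have gf: "g x = f x" "f x \<in> X - M" "g (f x) = f x" "m \<sqsubset> f x" if "x \<in> X - M" for x
      using that f m(2) by (auto simp: g_def spine_map_def)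
    have "m \<in> X" using m(1) by (simp add: M_def)
    have "spine_map lt X g"
      unfolding spine_map_def
    proof (intro conjI ballI impI)
      fix x assume x: "x \<in> X"
      show "g x \<in> X" "g (g x) = g x"
        using x \<open>m \<in> X\<close> m(1) gM gf by (cases "x \<in> M"; simp)+
      fix y assume y: "y \<in> X"
      show "\<not> x \<sqsubset> y" if "g x = g y"
      proof (cases "x \<in> M \<or> y \<in> M")
        case True
        then have "y \<in> M" using that x y gM gf irrefl by (metis DiffI)
        then show ?thesis using x by (simp add: M_def)
      next
        case False
        then have "f x = f y" using that x y gf(1) by simp
        then show ?thesis using False x y f by (simp add: spine_map_def)
      qed
      show "g x = g y \<or> g x \<sqsubset> g y \<or> g y \<sqsubset> g x"
      proof (cases "x \<in> M \<or> y \<in> M")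
        case True
        then show ?thesis using x y gM gf by (metis DiffI)
      next
        case False
        then have "g x = f x" "g y = f y" using x y gf(1) by simp_all
        then show ?thesis using False x y f by (simp add: spine_map_def)
      qed
    qed
    then show ?thesis by blast
  qed
qed

end

text \<open>Compactness of a product of finite sets, by a diagonal argument: infinite sets of stages
  are thinned out successively so that one more coordinate becomes constant.\<close>

lemma pointwise_compactness:
  fixes u :: "nat \<Rightarrow> nat \<Rightarrow> 'b"
  assumes fin: "\<And>k. finite (B k)" and B: "\<And>k n. k \<le> n \<Longrightarrow> u n k \<in> B k"
  shows "\<exists>v. \<forall>k. \<exists>n\<ge>k. \<forall>i\<le>k. u n i = v i"
proof -
  have step: "\<exists>N'\<subseteq>N. infinite N' \<and> (\<exists>b. \<forall>n\<in>N'. u n k = b)" if N: "infinite N" for N k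
  proof -
    \<comment> \<open>The bound \<open>B k\<close> holds only from stage \<open>k\<close> on, so the
      earlier stages are dropped.\<close>
    have inf: "infinite (N - {..<k})" using N by simp
    have "finite ((\<lambda>n. u n k) ` (N - {..<k}))"
      by (rule finite_subset[OF _ fin[of k]]) (auto intro: B)
    then obtain a where "a \<in> N - {..<k}" "infinite {n \<in> N - {..<k}. u n k = u a k}"
      using pigeonhole_infinite[OF inf] by blast
    then show ?thesis
      by (intro exI[of _ "{n \<in> N - {..<k}. u n k = u a k}"]) auto
  qed
  have "\<exists>N. \<forall>k. infinite (N k) \<and> (N (Suc k) \<subseteq> N k \<and> (\<exists>b. \<forall>n\<in>N (Suc k). u n k = b))"
    by (rule dependent_nat_choice[where P = "\<lambda>k N. infinite N" and Q = "\<lambda>k N N'. N' \<subseteq> N \<and> (\<exists>b. \<forall>n\<in>N'. u n k = b)"])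
      (use step infinite_UNIV_nat in \<open>meson, meson\<close>)
  then obtain N where N: "\<And>k. infinite (N k)" "\<And>k. N (Suc k) \<subseteq> N k"
    and "\<forall>k. \<exists>b. \<forall>n\<in>N (Suc k). u n k = b" by blast
  then obtain v where v: "\<And>k n. n \<in> N (Suc k) \<Longrightarrow> u n k = v k" by metis
  have anti: "i \<le> j \<Longrightarrow> N j \<subseteq> N i" for i j
    using N(2) by (rule lift_Suc_antimono_le)
  have "\<exists>n\<ge>k. \<forall>i\<le>k. u n i = v i" for k
  proof -
    obtain n where n: "n \<in> N (Suc k)" "n \<ge> k"
      using N(1)[of "Suc k"] by (meson infinite_nat_iff_unbounded_le)
    have "n \<in> N (Suc i)" if "i \<le> k" for i
      using n(1) anti[of "Suc i" "Suc k"] that by auto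
    then have "\<forall>i\<le>k. u n i = v i" using v by blast
    then show ?thesis using n(2) by blast
  qed
  then show ?thesis by blast
qed

context fac_order
begin

text \<open>Finite initial segments of an enumeration have spine maps, and each point has only
  finitely many possible images, so a pointwise limit exists. Being a spine map is a condition on
  finitely many points at a time and passes to the limit.\<close>

lemma star_spine_map:
  assumes Q: "star lt Q" "Q \<subseteq> P" "Q \<noteq> {}"
  shows "\<exists>f. spine_map lt Q f"
proof -
  have cQ: "countable Q" using Q(2) countable_carrier countable_subset by blast
  define q where "q = from_nat_into Q"
  have rq: "range q = Q" using cQ Q(3) by (simp add: q_def)
  have "\<forall>n. \<exists>g. spine_map lt (q ` {..n}) g" using finite_spine_map by simp
  then obtain g where g: "\<And>n. spine_map lt (q ` {..n}) (g n)" by metis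
  \<comment> \<open>A spine map sends a point to a member of its own antichain, that is, to itself
    or to an incomparable point.\<close>
  define B where "B k = {y \<in> Q. \<not> q k \<sqsubset> y \<and> \<not> y \<sqsubset> q k}" for k
  have "\<exists>v. \<forall>k. \<exists>n\<ge>k. \<forall>i\<le>k. g n (q i) = v i"
  proof (rule pointwise_compactness[where B = B])
    show "finite (B k)" for k
      using star_finite_incomparable[OF Q(1,2), of "q k"] rq by (auto simp: B_def)
    show "g n (q k) \<in> B k" if "k \<le> n" for k n
    proof -
      have qk: "q k \<in> q ` {..n}" using that by auto
      then have "g n (q k) \<in> q ` {..n}" "g n (g n (q k)) = g n (q k)"
        using g[of n] by (auto simp: spine_map_def)
      then have "\<not> q k \<sqsubset> g n (q k)" "\<not> g n (q k) \<sqsubset> q k"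
        using g[of n] qk unfolding spine_map_def by metis+
      then show ?thesis using \<open>g n (q k) \<in> q ` {..n}\<close> rq by (auto simp: B_def)
    qed
  qed
  then obtain v where v: "\<And>k. \<exists>n\<ge>k. \<forall>i\<le>k. g n (q i) = v i" by blast
  \<comment> \<open>The enumeration \<open>q\<close> repeats values when \<open>Q\<close> is finite,
    so one index per point is fixed.\<close>
  define idx where "idx x = (SOME i. q i = x)" for x
  have idx: "q (idx x) = x" if "x \<in> Q" for x
    using that rq unfolding idx_def by (metis (mono_tags, lifting) imageE someI_ex)
  define f where "f x = v (idx x)" for x
  have approx: "\<exists>n. F \<subseteq> q ` {..n} \<and> (\<forall>x\<in>F. g n x = f x)" if "finite F" "F \<subseteq> Q" for F
  proof -
    have "finite (idx ` F)" using \<open>finite F\<close> by simp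
    then obtain k where k: "\<And>x. x \<in> F \<Longrightarrow> idx x \<le> k"
      unfolding finite_nat_set_iff_bounded_le by blast
    obtain n where n: "n \<ge> k" "\<And>i. i \<le> k \<Longrightarrow> g n (q i) = v i" using v by blast
    have "x = q (idx x) \<and> idx x \<le> n \<and> g n x = f x" if "x \<in> F" for x
      using that \<open>F \<subseteq> Q\<close> idx k n unfolding f_def by (metis order_trans subsetD)
    then show ?thesis by (intro exI[of _ n]) auto
  qed
  have fQ: "f x \<in> Q" if "x \<in> Q" for x
  proof -
    obtain n where "{x} \<subseteq> q ` {..n}" "g n x = f x" using approx[of "{x}"] \<open>x \<in> Q\<close> by auto
    then show ?thesis using g[of n] rq unfolding spine_map_def by (metis image_subset_iff insert_subset subset_UNIV subsetD image_mono)
  qed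
  have "spine_map lt Q f"
    unfolding spine_map_def
  proof (intro conjI ballI impI)
    fix x assume x: "x \<in> Q"
    show "f x \<in> Q" using fQ x .
    obtain n where "{x, f x} \<subseteq> q ` {..n}" "\<forall>z\<in>{x, f x}. g n z = f z"
      using approx[of "{x, f x}"] x fQ by auto
    then have "x \<in> q ` {..n}" "g n x = f x" "g n (f x) = f (f x)" by auto
    then show "f (f x) = f x" using g[of n] unfolding spine_map_def by metis
    fix y assume y: "y \<in> Q"
    obtain n where n: "{x, y} \<subseteq> q ` {..n}" "\<forall>z\<in>{x, y}. g n z = f z"
      using approx[of "{x, y}"] x y by auto
    have xy: "x \<in> q ` {..n}" "y \<in> q ` {..n}" "g n x = f x" "g n y = f y"
      using n by auto
    show "\<not> x \<sqsubset> y" if "f x = f y"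
      using g[of n] xy that unfolding spine_map_def by metis
    show "f x = f y \<or> f x \<sqsubset> f y \<or> f y \<sqsubset> f x"
      using g[of n] xy unfolding spine_map_def by metis
  qed
  then show ?thesis by blast
qed

end

section \<open>Splitting points and discrete pairs\<close>

text \<open>Such points are what remains when \<open>I\<close> has neither an infinite well-founded
  beginning nor an infinite co-well-founded end. Iterating the notion, by asking for splitting
  points below and above \<open>c\<close>, plays the role of a rank that separates the scattered
  case from the dense one.\<close>

definition splits :: "('a \<Rightarrow> 'a \<Rightarrow> bool) \<Rightarrow> 'a set \<Rightarrow> 'a \<Rightarrow> bool" where
  "splits lt I c \<longleftrightarrow> c \<in> I \<and> \<not> noasc lt\<inverse>\<inverse> {x \<in> I. lt x c} \<and> \<not> noasc lt {x \<in> I. lt c x}"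

lemma splits_conversep [simp]: "splits lt\<inverse>\<inverse> I c = splits lt I c"
  by (auto simp: splits_def)

lemma splits_mono: "splits lt I c \<Longrightarrow> I \<subseteq> J \<Longrightarrow> splits lt J c"
  using noasc_subset[of "lt\<inverse>\<inverse>" "{x \<in> J. lt x c}" "{x \<in> I. lt x c}"]
    noasc_subset[of lt "{x \<in> J. lt c x}" "{x \<in> I. lt c x}"]
  unfolding splits_def by auto

definition discrete_pair :: "('a \<Rightarrow> 'a \<Rightarrow> bool) \<Rightarrow> 'a set \<Rightarrow> (nat \<Rightarrow> 'a) \<Rightarrow> (nat \<Rightarrow> 'a) \<Rightarrow> bool" where
  "discrete_pair lt I d a \<longleftrightarrow> asc lt\<inverse>\<inverse> I d \<and> asc lt I a \<and> lt (d 0) (a 0) \<and>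
     (\<forall>i j. finite (oi lt (d i) (a j)))"

lemma successor_sequence:
  assumes "x \<in> Y" "\<And>u. u \<in> Y \<Longrightarrow> \<exists>z\<in>Y. R u z"
  shows "\<exists>f :: nat \<Rightarrow> 'a. \<forall>n. f n \<in> Y \<and> R (f n) (f (Suc n))"
  using dependent_nat_choice[of "\<lambda>n y. y \<in> Y" "\<lambda>n y z. R y z"] assms by blast

locale vac_order = fac_order lt P for lt :: "'a \<Rightarrow> 'a \<Rightarrow> bool" (infix "\<sqsubset>" 50) and P +
  assumes no_bad_asc: "no_bad_seq lt" and no_bad_desc: "no_bad_seq lt\<inverse>\<inverse>"
begin

lemma vac_dual: "vac_order lt\<inverse>\<inverse> P"
  using dual no_bad_asc no_bad_desc by (simp add: vac_order_def vac_order_axioms_def)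

lemma desc_less: "asc lt\<inverse>\<inverse> X f \<Longrightarrow> i < j \<Longrightarrow> f j \<sqsubset> f i"
proof -
  interpret d: vac_order "lt\<inverse>\<inverse>" P by (rule vac_dual)
  show "asc lt\<inverse>\<inverse> X f \<Longrightarrow> i < j \<Longrightarrow> f j \<sqsubset> f i"
    using d.asc_less[of X f i j] by simp
qed

lemma desc_infinite: "asc lt\<inverse>\<inverse> X f \<Longrightarrow> infinite X"
proof -
  interpret d: vac_order "lt\<inverse>\<inverse>" P by (rule vac_dual)
  show "asc lt\<inverse>\<inverse> X f \<Longrightarrow> infinite X"
    using d.asc_infinite by blast
qed

lemma oi_subset_P: "oi lt x y \<subseteq> P"
  using field by (auto simp: oi_def)

text \<open>This is how vacillation is applied: if every \<open>u\<close> had an infinite interval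
  above it inside \<open>Y\<close>, iteration would produce a forbidden ascending sequence.\<close>

lemma eventually_maximal:
  assumes Y: "\<And>u v. u \<in> Y \<Longrightarrow> v \<in> Y \<Longrightarrow> u \<sqsubset> v \<Longrightarrow> noasc lt (oi lt u v)"
    and "x \<in> Y"
  shows "\<exists>u\<in>Y. \<forall>z\<in>Y. u \<sqsubset> z \<longrightarrow> finite (oi lt u z)"
proof (rule ccontr)
  assume "\<not> ?thesis"
  then have "\<forall>u\<in>Y. \<exists>z\<in>Y. u \<sqsubset> z \<and> infinite (oi lt u z)" by blast
  then have "\<exists>f. \<forall>n. f n \<in> Y \<and> (f n \<sqsubset> f (Suc n) \<and> infinite (oi lt (f n) (f (Suc n))))"
    using assms(2) by (intro successor_sequence) auto
  then obtain f where f: "\<forall>n. f n \<in> Y \<and> (f n \<sqsubset> f (Suc n) \<and> infinite (oi lt (f n) (f (Suc n))))"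
    ..
  then have "noasc lt (oi lt (f n) (f (Suc n)))" for n using Y[of "f n" "f (Suc n)"] by auto
  with f have "\<forall>i. f i \<sqsubset> f (Suc i) \<and> infinite (oi lt (f i) (f (Suc i))) \<and> noasc lt (oi lt (f i) (f (Suc i)))"
    by auto
  then show False using no_bad_asc unfolding no_bad_seq_def by (auto dest: spec[of _ f])
qed

text \<open>One point with finite intervals above it is not enough; a whole descending sequence of
  them is needed. If there are exceptional points, take \<open>u\<close> that is nearly maximal
  among these. An infinite interval above \<open>u\<close> holds a descending sequence, and each of
  its terms still has infinitely many points between itself and \<open>u\<close>, so none of them is
  exceptional.\<close>

lemma nearly_maximal_desc:
  assumes conv: "ordconvex lt Y"
    and Y: "\<And>u v. u \<in> Y \<Longrightarrow> v \<in> Y \<Longrightarrow> u \<sqsubset> v \<Longrightarrow> noasc lt (oi lt u v)"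
    and d: "asc lt\<inverse>\<inverse> Y d"
  shows "\<exists>w. asc lt\<inverse>\<inverse> Y w \<and> (\<forall>j. \<forall>z\<in>Y. w j \<sqsubset> z \<longrightarrow> finite (oi lt (w j) z))"
proof -
  define M where "M = {u \<in> Y. \<forall>z\<in>Y. u \<sqsubset> z \<longrightarrow> finite (oi lt u z)}"
  show ?thesis
  proof (cases "Y \<subseteq> M")
    case True
    then show ?thesis using d by (intro exI[of _ d]) (auto simp: M_def asc_def)
  next
    case False
    then obtain u where u: "u \<in> Y - M" "\<forall>z\<in>Y - M. u \<sqsubset> z \<longrightarrow> finite (oi lt u z)"
      using eventually_maximal[of "Y - M"] Y by blast
    then obtain z where z: "z \<in> Y" "u \<sqsubset> z" "infinite (oi lt u z)" by (auto simp: M_def)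
    have "noasc lt (oi lt u z)" using Y u(1) z by blast
    then obtain x where x: "asc lt\<inverse>\<inverse> (oi lt u z) x"
      using infinite_asc_or_desc[OF oi_subset_P z(3)] by (auto simp: noasc_def)
    have "x l \<in> M" for l
    proof -
      have ux: "u \<sqsubset> x i" "x i \<sqsubset> z" for i using x by (auto simp: asc_def oi_def)
      have "asc lt\<inverse>\<inverse> (oi lt u (x l)) (\<lambda>i. x (i + Suc l))"
        using asc_shift[OF x, of "Suc l"] desc_less[OF x] ux by (auto simp: asc_def oi_def)
      then have "infinite (oi lt u (x l))" by (rule desc_infinite)
      moreover have "x l \<in> Y" using conv u(1) z(1) ux by (auto intro: ordconvexD)
      ultimately show ?thesis using u(2) ux by blast
    qed
    then show ?thesis using x by (intro exI[of _ x]) (auto simp: M_def asc_def)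
  qed
qed

lemma nearly_minimal_asc:
  assumes "ordconvex lt Y"
    and "\<And>u v. u \<in> Y \<Longrightarrow> v \<in> Y \<Longrightarrow> u \<sqsubset> v \<Longrightarrow> noasc lt\<inverse>\<inverse> (oi lt u v)"
    and "asc lt Y a"
  shows "\<exists>w. asc lt Y w \<and> (\<forall>j. \<forall>z\<in>Y. z \<sqsubset> w j \<longrightarrow> finite (oi lt z (w j)))"
proof -
  interpret d: vac_order "lt\<inverse>\<inverse>" P by (rule vac_dual)
  show ?thesis
    using d.nearly_maximal_desc[of Y a] assms by simp
qed

text \<open>An ascending sequence between \<open>c\<close> and \<open>c'\<close>, together with the
  descending sequence that \<open>c\<close> already has below it, would make \<open>c\<close> split
  the part below \<open>c'\<close>.\<close>

lemma split_noasc: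
  assumes I: "ordconvex lt I" and c: "splits lt I c" "c' \<in> I" "c \<sqsubset> c'"
    and n: "\<nexists>x. splits lt {y \<in> I. y \<sqsubset> c'} x"
  shows "noasc lt (oi lt c c')"
proof (rule ccontr)
  assume a: "\<not> noasc lt (oi lt c c')"
  have "{x \<in> {y \<in> I. y \<sqsubset> c'}. x \<sqsubset> c} = {x \<in> I. x \<sqsubset> c}"
    using c trans by blast
  moreover have "{x \<in> {y \<in> I. y \<sqsubset> c'}. c \<sqsubset> x} = oi lt c c'"
    using I c by (auto simp: oi_def splits_def intro: ordconvexD)
  ultimately have "splits lt {y \<in> I. y \<sqsubset> c'} c"
    using a c unfolding splits_def by auto
  then show False using n by blast
qed

text \<open>The terms of a descending sequence witnessing that \<open>c\<close> splits do split
  \<open>I\<close> themselves: the tail lies below, and what ascends above \<open>c\<close> lies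
  above them too.\<close>

lemma split_desc_below:
  assumes "splits lt I c"
  shows "\<exists>d. asc lt\<inverse>\<inverse> {x. splits lt I x \<and> x \<sqsubset> c} d"
proof -
  obtain d where d: "asc lt\<inverse>\<inverse> {x \<in> I. x \<sqsubset> c} d"
    using assms by (auto simp: splits_def noasc_def)
  have dc: "d i \<in> I" "d i \<sqsubset> c" for i using d by (auto simp: asc_def)
  have "splits lt I (d i)" for i
  proof -
    have "asc lt\<inverse>\<inverse> {x \<in> I. x \<sqsubset> d i} (\<lambda>j. d (j + Suc i))"
      using asc_shift[OF d, of "Suc i"] desc_less[OF d] by (auto simp: asc_def)
    then have "\<not> noasc lt\<inverse>\<inverse> {x \<in> I. x \<sqsubset> d i}" by (auto simp: noasc_def)
    moreover have "{x \<in> I. c \<sqsubset> x} \<subseteq> {x \<in> I. d i \<sqsubset> x}"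
      using dc trans by blast
    from noasc_subset[OF _ this] have "\<not> noasc lt {x \<in> I. d i \<sqsubset> x}"
      using assms unfolding splits_def by auto
    ultimately show ?thesis using dc by (simp add: splits_def)
  qed
  then show ?thesis using d by (intro exI[of _ d]) (auto simp: asc_def)
qed

lemma splits_between:
  assumes "ordconvex lt I" "splits lt I c" "x \<in> I" "c \<sqsubset> x" "\<not> noasc lt {y \<in> I. x \<sqsubset> y}"
  shows "splits lt I x"
proof -
  have "{y \<in> I. y \<sqsubset> c} \<subseteq> {y \<in> I. y \<sqsubset> x}" using assms trans by blast
  from noasc_subset[OF _ this] show ?thesis using assms unfolding splits_def by auto
qed

text \<open>
  The set of splitting points falls into those whose lower part is again split and those whose
  upper part is again split, or neither.  Inside the first class all intervals are well-founded,
  inside the second they are co-well-founded; vacillation then yields points whose intervals to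
  everything else in the class are finite.
\<close>

lemma discrete_pair_exists:
  assumes I: "ordconvex lt I" "I \<subseteq> P" and c0: "splits lt I c0"
    and single: "\<And>c. c \<in> I \<Longrightarrow> \<exists>x. splits lt {y \<in> I. y \<sqsubset> c} x \<Longrightarrow> \<nexists>x. splits lt {y \<in> I. c \<sqsubset> y} x"
  shows "\<exists>d a. discrete_pair lt I d a"
proof -
  interpret d: vac_order "lt\<inverse>\<inverse>" P by (rule vac_dual)
  define X where "X = {c. splits lt I c}"
  define \<alpha> where "\<alpha> c \<longleftrightarrow> (\<exists>x. splits lt {y \<in> I. y \<sqsubset> c} x)" for c
  define \<beta> where "\<beta> c \<longleftrightarrow> (\<exists>x. splits lt {y \<in> I. c \<sqsubset> y} x)" for c
  have XI: "x \<in> I" if "x \<in> X" for x using that by (simp add: X_def splits_def)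
  have not_both: "\<not> \<beta> c" if "\<alpha> c" "c \<in> X" for c
    using single[OF XI] that by (simp add: \<alpha>_def \<beta>_def)
  have \<alpha>_mono: "\<alpha> c'" if "\<alpha> c" "c \<sqsubset> c'" for c c'
  proof -
    have "{y \<in> I. y \<sqsubset> c} \<subseteq> {y \<in> I. y \<sqsubset> c'}" using that trans by blast
    then show ?thesis using that(1) splits_mono[of lt "{y \<in> I. y \<sqsubset> c}"] unfolding \<alpha>_def by meson
  qed
  have \<beta>_mono: "\<beta> c" if "\<beta> c'" "c \<sqsubset> c'" for c c'
  proof -
    have "{y \<in> I. c' \<sqsubset> y} \<subseteq> {y \<in> I. c \<sqsubset> y}" using that trans by blast
    then show ?thesis using that(1) splits_mono[of lt "{y \<in> I. c' \<sqsubset> y}"] unfolding \<beta>_def by meson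
  qed
  have noasc_\<alpha>: "noasc lt (oi lt c c')" if "c \<in> X" "c' \<in> X" "c \<sqsubset> c'" "\<not> \<alpha> c'" for c c'
    using split_noasc[OF I(1), of c c'] that XI[of c'] by (simp add: X_def \<alpha>_def)
  have nodesc_\<beta>: "noasc lt\<inverse>\<inverse> (oi lt c c')" if "c \<in> X" "c' \<in> X" "c \<sqsubset> c'" "\<not> \<beta> c" for c c'
    using d.split_noasc[of I c' c] I(1) that XI[of c] by (simp add: X_def \<beta>_def)
  have X_above: "x \<in> X" if "c \<in> X" "x \<in> I" "c \<sqsubset> x" "\<not> noasc lt {y \<in> I. x \<sqsubset> y}" for c x
    using splits_between[OF I(1)] that by (auto simp: X_def)
  have X_conv: "x \<in> X" if "u \<in> X" "v \<in> X" "u \<sqsubset> x" "x \<sqsubset> v" for u v x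
  proof (rule X_above[OF that(1) _ that(3)])
    show "x \<in> I" using ordconvexD[OF I(1) XI[OF that(1)] XI[OF that(2)]] that by simp
    have "{y \<in> I. v \<sqsubset> y} \<subseteq> {y \<in> I. x \<sqsubset> y}" using that trans by blast
    from noasc_subset[OF _ this] show "\<not> noasc lt {y \<in> I. x \<sqsubset> y}"
      using that(2) unfolding X_def splits_def by auto
  qed
  \<comment> \<open>\<open>\<alpha>\<close> is inherited upwards, so \<open>N\<close> is an initial
    part of \<open>X\<close>; its intervals contain no ascending sequence by
    \<open>noasc_\<alpha>\<close>.\<close>
  define N where "N = {c \<in> X. \<not> \<alpha> c}"
  \<comment> \<open>If all of \<open>X\<close> satisfied \<open>\<alpha>\<close>, none of it would
    satisfy \<open>\<beta>\<close>, and the dual of \<open>eventually_maximal\<close> would give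
    \<open>u\<close> with finite intervals below it; but a point splitting the part below
    \<open>u\<close> has an ascending sequence between itself and \<open>u\<close>.\<close>
  have "\<exists>c. c \<in> N"
  proof (rule ccontr)
    assume "\<nexists>c. c \<in> N"
    then have all: "\<alpha> c" if "c \<in> X" for c using that by (auto simp: N_def)
    obtain u where u: "u \<in> X" "\<forall>z\<in>X. z \<sqsubset> u \<longrightarrow> finite (oi lt z u)"
      using d.eventually_maximal[of X c0] nodesc_\<beta> not_both all c0 by (auto simp: X_def)
    obtain z where z: "splits lt {y \<in> I. y \<sqsubset> u} z" using all[OF u(1)] by (auto simp: \<alpha>_def)
    then have "z \<in> X" "z \<sqsubset> u"
      using splits_mono[OF z, of I] by (auto simp: X_def splits_def)
    have "{x \<in> {y \<in> I. y \<sqsubset> u}. z \<sqsubset> x} \<subseteq> oi lt z u" by (auto simp: oi_def)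
    from noasc_subset[OF _ this] have "\<not> noasc lt (oi lt z u)" using z unfolding splits_def by auto
    then have "infinite (oi lt z u)" using finite_noasc by blast
    then show False using u(2) \<open>z \<in> X\<close> \<open>z \<sqsubset> u\<close> by blast
  qed
  then obtain c where c: "c \<in> N" by blast
  have N_conv: "ordconvex lt N"
    unfolding ordconvex_def oi_def N_def using X_conv \<alpha>_mono by blast
  have N_noasc: "noasc lt (oi lt u v)" if "u \<in> N" "v \<in> N" "u \<sqsubset> v" for u v
    using noasc_\<alpha> that by (auto simp: N_def)
  obtain d0 where d0: "asc lt\<inverse>\<inverse> {x. splits lt I x \<and> x \<sqsubset> c} d0"
    using split_desc_below c by (auto simp: N_def X_def)
  have "{x. splits lt I x \<and> x \<sqsubset> c} \<subseteq> N"
    using c \<alpha>_mono by (auto simp: N_def X_def)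
  then have "asc lt\<inverse>\<inverse> N d0" using d0 asc_subset by blast
  then obtain e where e: "asc lt\<inverse>\<inverse> N e" "\<And>j z. z \<in> N \<Longrightarrow> e j \<sqsubset> z \<Longrightarrow> finite (oi lt (e j) z)"
    using nearly_maximal_desc[OF N_conv N_noasc] by blast
  have eN: "e j \<in> N" for j using e(1) by (simp add: asc_def)
  then have eX: "e j \<in> X" for j by (simp add: N_def)
  \<comment> \<open>The upper counterpart of \<open>N\<close>, cut down to points above some
    \<open>e j\<close> so that the ascending sequence found in it can be joined to
    \<open>e\<close>.\<close>
  define Y where "Y = {x \<in> X. \<not> \<beta> x \<and> (\<exists>j. e j \<sqsubset> x)}"
  have "\<exists>x. x \<in> Y"
  proof (cases "\<beta> (e 0)")
    case False
    show ?thesis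
    proof (rule ccontr)
      assume no: "\<nexists>x. x \<in> Y"
      obtain a where a: "asc lt {x \<in> I. e 0 \<sqsubset> x} a"
        using eX[of 0] by (auto simp: X_def splits_def noasc_def)
      have "asc lt {y \<in> I. a 0 \<sqsubset> y} (\<lambda>i. a (i + Suc 0))"
        using asc_shift[OF a, of "Suc 0"] asc_less[OF a] by (auto simp: asc_def)
      then have "\<not> noasc lt {y \<in> I. a 0 \<sqsubset> y}" by (auto simp: noasc_def)
      then have "a 0 \<in> X" using X_above[of "e 0" "a 0"] eX a by (auto simp: asc_def)
      moreover have "\<not> \<beta> (a 0)" using False \<beta>_mono a by (auto simp: asc_def)
      ultimately have "a 0 \<in> Y" using a by (auto simp: Y_def asc_def)
      then show False using no by blast
    qed
  next
    case True
    then obtain z where z: "splits lt {y \<in> I. e 0 \<sqsubset> y} z" by (auto simp: \<beta>_def)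
    have zX: "z \<in> X" using splits_mono[OF z, of I] by (auto simp: X_def)
    obtain x where x: "asc lt\<inverse>\<inverse> {x \<in> {y \<in> I. e 0 \<sqsubset> y}. x \<sqsubset> z} x"
      using z by (auto simp: splits_def noasc_def)
    have x0: "x i \<in> I" "e 0 \<sqsubset> x i" "x i \<sqsubset> z" for i using x by (auto simp: asc_def)
    have "x 0 \<in> X" using X_conv[OF eX zX] x0 by blast
    have "asc lt\<inverse>\<inverse> (oi lt (e 0) (x 0)) (\<lambda>i. x (i + Suc 0))"
      using asc_shift[OF x, of "Suc 0"] desc_less[OF x] x0 by (auto simp: asc_def oi_def)
    \<comment> \<open>From \<open>e 0\<close> all intervals to points of \<open>N\<close> are
      finite, so \<open>x 0\<close> is outside \<open>N\<close>; it then satisfies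
      \<open>\<alpha>\<close> and, by \<open>not_both\<close>, fails \<open>\<beta>\<close>.\<close>
    then have "infinite (oi lt (e 0) (x 0))" by (rule desc_infinite)
    then have "x 0 \<notin> N" using e(2) x0 by blast
    then have "\<not> \<beta> (x 0)" using \<open>x 0 \<in> X\<close> not_both by (auto simp: N_def)
    then show ?thesis using \<open>x 0 \<in> X\<close> x0 by (auto simp: Y_def)
  qed
  then obtain y where y: "y \<in> Y" by blast
  have Y_conv: "ordconvex lt Y"
    unfolding ordconvex_def oi_def Y_def using X_conv \<beta>_mono trans by blast
  have Y_nodesc: "noasc lt\<inverse>\<inverse> (oi lt u v)" if "u \<in> Y" "v \<in> Y" "u \<sqsubset> v" for u v
    using nodesc_\<beta> that by (auto simp: Y_def)
  obtain a0 where a0: "asc lt {x. splits lt I x \<and> y \<sqsubset> x} a0"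
    using d.split_desc_below[of I y] y by (auto simp: Y_def X_def)
  have "{x. splits lt I x \<and> y \<sqsubset> x} \<subseteq> Y"
    using y \<beta>_mono trans unfolding Y_def X_def by blast
  then have "asc lt Y a0" using a0 asc_subset by blast
  then obtain a where a: "asc lt Y a" "\<And>j z. z \<in> Y \<Longrightarrow> z \<sqsubset> a j \<Longrightarrow> finite (oi lt z (a j))"
    using nearly_minimal_asc[OF Y_conv Y_nodesc] by blast
  have aY: "a j \<in> Y" for j using a(1) by (simp add: asc_def)
  obtain j0 where j0: "e j0 \<sqsubset> a 0" using aY[of 0] by (auto simp: Y_def)
  define e' where "e' = (\<lambda>j. e (j + j0))"
  have e': "asc lt\<inverse>\<inverse> N e'" "e' 0 \<sqsubset> a 0" "\<And>j z. z \<in> N \<Longrightarrow> e' j \<sqsubset> z \<Longrightarrow> finite (oi lt (e' j) z)"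
    using asc_shift[OF e(1), of j0] e(2) j0 by (auto simp: e'_def)
  have ea: "e' i \<sqsubset> a j" for i j
    using desc_less[OF e'(1), of 0 i] asc_less[OF a(1), of 0 j] e'(2) trans
    by (metis gr0I)
  have NI: "N \<subseteq> I" "Y \<subseteq> I" using XI by (auto simp: N_def Y_def)
  have eI: "asc lt\<inverse>\<inverse> I e'" "asc lt I a"
    using asc_subset[OF e'(1) NI(1)] asc_subset[OF a(1) NI(2)] .
  show ?thesis
  proof (cases "\<forall>i j. finite (oi lt (e' i) (a j))")
    case True
    then show ?thesis using eI e'(2) by (auto simp: discrete_pair_def)
  next
    case False
    then obtain i j where ij: "infinite (oi lt (e' i) (a j))" by blast
    \<comment> \<open>A point of \<open>X\<close> outside \<open>N\<close> satisfies
      \<open>\<alpha>\<close>, hence not \<open>\<beta>\<close>, and being above a term of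
      \<open>e\<close> it is in \<open>Y\<close>. So an infinite interval between the two sequences
      has an infinite half in \<open>N\<close> or in \<open>Y\<close>, and a monotone sequence there
      replaces one member of the pair.\<close>
    have sub: "x \<in> N \<or> x \<in> Y" if "x \<in> oi lt (e' i) (a j)" for x
    proof -
      have ex: "e (i + j0) \<sqsubset> x" "x \<sqsubset> a j" using that by (auto simp: oi_def e'_def)
      have "a j \<in> X" using aY by (simp add: Y_def)
      then have "x \<in> X" using X_conv[OF eX] ex by blast
      then show ?thesis using not_both[of x] ex(1) unfolding N_def Y_def by blast
    qed
    have "oi lt (e' i) (a j) = (oi lt (e' i) (a j) \<inter> N) \<union> (oi lt (e' i) (a j) \<inter> Y)"
      using sub by blast
    then have "\<not> (finite (oi lt (e' i) (a j) \<inter> N) \<and> finite (oi lt (e' i) (a j) \<inter> Y))"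
      using ij by (metis (no_types) finite_Un)
    then consider "infinite (oi lt (e' i) (a j) \<inter> N)" | "infinite (oi lt (e' i) (a j) \<inter> Y)"
      by blast
    then show ?thesis
    proof cases
      case 1
      then obtain m where m: "asc lt (oi lt (e' i) (a j) \<inter> N) m \<or> asc lt\<inverse>\<inverse> (oi lt (e' i) (a j) \<inter> N) m"
        using infinite_asc_or_desc[OF _ 1] oi_subset_P by (meson le_infI1)
      have mm: "m k \<in> N" "e' i \<sqsubset> m k" for k using m by (auto simp: asc_def oi_def)
      \<comment> \<open>If \<open>m\<close> descended, infinitely many of its terms would lie
        between \<open>e' i\<close> and \<open>m 0\<close>, although both ends are in
        \<open>N\<close>.\<close>
      have "asc lt I m"
      proof (rule ccontr)
        assume "\<not> asc lt I m"
        moreover have "oi lt (e' i) (a j) \<inter> N \<subseteq> I" using NI by blast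
        ultimately have d: "asc lt\<inverse>\<inverse> (oi lt (e' i) (a j) \<inter> N) m"
          using m asc_subset[of lt] by metis
        have "asc lt\<inverse>\<inverse> (oi lt (e' i) (m 0)) (\<lambda>k. m (k + Suc 0))"
          using asc_shift[OF d, of "Suc 0"] desc_less[OF d] by (auto simp: asc_def oi_def)
        then have "infinite (oi lt (e' i) (m 0))" by (rule desc_infinite)
        then show False using e'(3) mm by blast
      qed
      moreover have "asc lt\<inverse>\<inverse> I (\<lambda>k. e' (k + i))" using eI(1) by (rule asc_shift)
      moreover have em: "e' (k + i) \<sqsubset> m l" for k l
        using desc_less[OF e'(1), of i "k + i"] mm(2)[of l] trans[of "e' (k + i)" "e' i"] by (cases k) simp_all
      then have "finite (oi lt (e' (k + i)) (m l))" for k l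
        using e'(3) mm by blast
      ultimately have "discrete_pair lt I (\<lambda>k. e' (k + i)) m"
        unfolding discrete_pair_def using em[of 0 0] by simp
      then show ?thesis by (intro exI)
    next
      case 2
      then obtain m where m: "asc lt (oi lt (e' i) (a j) \<inter> Y) m \<or> asc lt\<inverse>\<inverse> (oi lt (e' i) (a j) \<inter> Y) m"
        using infinite_asc_or_desc[OF _ 2] oi_subset_P by (meson le_infI1)
      have mm: "m k \<in> Y" "m k \<sqsubset> a j" for k using m by (auto simp: asc_def oi_def)
      have "asc lt\<inverse>\<inverse> I m"
      proof (rule ccontr)
        assume "\<not> asc lt\<inverse>\<inverse> I m"
        moreover have "oi lt (e' i) (a j) \<inter> Y \<subseteq> I" using NI by blast
        ultimately have d: "asc lt (oi lt (e' i) (a j) \<inter> Y) m"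
          using m asc_subset[of "lt\<inverse>\<inverse>"] by metis
        have "asc lt (oi lt (m 0) (a j)) (\<lambda>k. m (k + Suc 0))"
          using asc_shift[OF d, of "Suc 0"] asc_less[OF d] by (auto simp: asc_def oi_def)
        then have "infinite (oi lt (m 0) (a j))" by (rule asc_infinite)
        then show False using a(2) mm by blast
      qed
      moreover have "asc lt I (\<lambda>k. a (k + j))" using eI(2) by (rule asc_shift)
      moreover have ma: "m l \<sqsubset> a (k + j)" for k l
        using asc_less[OF a(1), of j "k + j"] mm(2)[of l] trans[of "m l" "a j"] by (cases k) simp_all
      then have "finite (oi lt (m l) (a (k + j)))" for k l
        using a(2) mm by blast
      ultimately have "discrete_pair lt I m (\<lambda>k. a (k + j))"
        unfolding discrete_pair_def using ma[of 0 0] by simp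
      then show ?thesis by (intro exI)
    qed
  qed
qed

end

section \<open>Region families\<close>

text \<open>With respect to the other regions, \<open>x\<close> could be added to
  \<open>Q\<close>.\<close>

definition compat :: "('a \<Rightarrow> 'a \<Rightarrow> bool) \<Rightarrow> 'a set set \<Rightarrow> 'a set \<Rightarrow> 'a \<Rightarrow> bool" where
  "compat lt \<Q> Q x \<longleftrightarrow> (\<forall>R\<in>\<Q>. (below lt R Q \<longrightarrow> below lt R {x}) \<and> (below lt Q R \<longrightarrow> below lt {x} R))"

text \<open>Stated with elements because \<open>R'\<close> may be \<open>R\<close> itself: only an
  \<open>l\<close> with nothing above it in any region below \<open>Q\<close> violates the
  condition.\<close>

definition no_last_below :: "('a \<Rightarrow> 'a \<Rightarrow> bool) \<Rightarrow> 'a set set \<Rightarrow> 'a set \<Rightarrow> bool" where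
  "no_last_below lt \<Q> Q \<longleftrightarrow> (\<forall>R\<in>\<Q>. below lt R Q \<longrightarrow> (\<forall>l\<in>R. \<exists>R'\<in>\<Q>. below lt R' Q \<and> (\<exists>l'\<in>R'. lt l l')))"

text \<open>
  The third conjunct makes a region absorb every point that fits between its neighbours and is not
  beyond an infinite end of it; the last one says that an end of \<open>Q\<close> without infinite sequence
  borders a set of regions that has no last element, so that no two such ends are adjacent.
\<close>

definition region_family :: "('a \<Rightarrow> 'a \<Rightarrow> bool) \<Rightarrow> 'a set \<Rightarrow> 'a set set \<Rightarrow> bool" where
  "region_family lt T \<Q> \<longleftrightarrow>
     (\<forall>Q\<in>\<Q>. Q \<noteq> {} \<and> Q \<subseteq> T \<and> star lt Q) \<and>
     (\<forall>Q\<in>\<Q>. \<forall>R\<in>\<Q>. Q = R \<or> below lt Q R \<or> below lt R Q) \<and>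
     (\<forall>Q\<in>\<Q>. \<forall>x\<in>T. compat lt \<Q> Q x \<longrightarrow> (noasc lt Q \<or> (\<exists>q\<in>Q. lt x q)) \<longrightarrow>
        (noasc lt\<inverse>\<inverse> Q \<or> (\<exists>q\<in>Q. lt q x)) \<longrightarrow> x \<in> Q) \<and>
     (\<forall>Q\<in>\<Q>. (noasc lt\<inverse>\<inverse> Q \<longrightarrow> no_last_below lt \<Q> Q) \<and> (noasc lt Q \<longrightarrow> no_last_below lt\<inverse>\<inverse> \<Q> Q))"

lemma compat_conversep [simp]: "compat lt\<inverse>\<inverse> \<Q> Q x = compat lt \<Q> Q x"
  by (auto simp: compat_def)

lemma region_familyD:
  assumes "region_family lt T \<Q>" "Q \<in> \<Q>"
  shows "Q \<noteq> {}" "Q \<subseteq> T" "star lt Q"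
    and "R \<in> \<Q> \<Longrightarrow> Q = R \<or> below lt Q R \<or> below lt R Q"
    and "x \<in> T \<Longrightarrow> compat lt \<Q> Q x \<Longrightarrow> noasc lt Q \<or> (\<exists>q\<in>Q. lt x q) \<Longrightarrow>
          noasc lt\<inverse>\<inverse> Q \<or> (\<exists>q\<in>Q. lt q x) \<Longrightarrow> x \<in> Q"
    and "noasc lt\<inverse>\<inverse> Q \<Longrightarrow> no_last_below lt \<Q> Q"
    and "noasc lt Q \<Longrightarrow> no_last_below lt\<inverse>\<inverse> \<Q> Q"
  using assms unfolding region_family_def by blast+

lemma region_family_conversep [simp]: "region_family lt\<inverse>\<inverse> T \<Q> = region_family lt T \<Q>"
proof -
  have dual: "region_family lt\<inverse>\<inverse> T \<Q>" if r: "region_family lt T \<Q>" for lt :: "'a \<Rightarrow> 'a \<Rightarrow> bool"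
    unfolding region_family_def
  proof (intro conjI ballI impI)
    fix Q assume Q: "Q \<in> \<Q>"
    note D = region_familyD[OF r Q]
    show "Q \<noteq> {}" "Q \<subseteq> T" "star lt\<inverse>\<inverse> Q" using D(1-3) by simp_all
    show "Q = R \<or> below lt\<inverse>\<inverse> Q R \<or> below lt\<inverse>\<inverse> R Q" if "R \<in> \<Q>" for R
      using D(4)[OF that] by auto
    show "no_last_below lt\<inverse>\<inverse> \<Q> Q" if "noasc lt\<inverse>\<inverse>\<inverse>\<inverse> Q"
      using D(7) that by simp
    show "no_last_below lt\<inverse>\<inverse>\<inverse>\<inverse> \<Q> Q" if "noasc lt\<inverse>\<inverse> Q"
      using D(6) that by simp
    show "x \<in> Q" if "x \<in> T" "compat lt\<inverse>\<inverse> \<Q> Q x" "noasc lt\<inverse>\<inverse> Q \<or> (\<exists>q\<in>Q. lt\<inverse>\<inverse> x q)"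
      "noasc lt\<inverse>\<inverse>\<inverse>\<inverse> Q \<or> (\<exists>q\<in>Q. lt\<inverse>\<inverse> q x)" for x
      using D(5)[OF that(1)] that(2-) by simp
  qed
  show ?thesis using dual[of lt] dual[of "lt\<inverse>\<inverse>"] by auto
qed

context vac_order
begin

lemma below_irrefl: "Q \<noteq> {} \<Longrightarrow> \<not> below lt Q Q"
  using irrefl by (auto simp: below_def)

section \<open>Single regions cut out by minimal sequences\<close>

lemma singleton_region_family:
  assumes "Q \<noteq> {}" "Q \<subseteq> T" "star lt Q"
    and "\<And>x. x \<in> T \<Longrightarrow> noasc lt Q \<or> (\<exists>q\<in>Q. x \<sqsubset> q) \<Longrightarrow>
           noasc lt\<inverse>\<inverse> Q \<or> (\<exists>q\<in>Q. q \<sqsubset> x) \<Longrightarrow> x \<in> Q"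
  shows "region_family lt T {Q}"
  using assms below_irrefl[OF assms(1)] unfolding region_family_def no_last_below_def
  by simp

text \<open>Well-foundedness of the down-closures of ascending sequences: from a strictly decreasing
  sequence of down-closures one term each can be chosen so that the chosen terms form an infinite
  antichain.\<close>

lemma minimal_asc:
  assumes Q: "Q \<subseteq> P" "\<And>x y. x \<in> Q \<Longrightarrow> y \<in> Q \<Longrightarrow> finite (oi lt x y)" and a: "asc lt Q a"
  shows "\<exists>y. asc lt Q y \<and> (\<forall>z. asc lt Q z \<longrightarrow> (\<forall>i. \<exists>j. z i \<sqsubset> y j) \<longrightarrow> (\<forall>i. \<exists>j. y i \<sqsubset> z j))"
proof (rule ccontr)
  assume no: "\<not> ?thesis"
  define R where "R y z \<longleftrightarrow> (\<forall>i. \<exists>j. z i \<sqsubset> y j) \<and> (\<exists>i. \<forall>j. \<not> y i \<sqsubset> z j)" for y z :: "nat \<Rightarrow> 'a"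
  have "\<exists>z\<in>{y. asc lt Q y}. R y z" if "y \<in> {y. asc lt Q y}" for y
    using no that unfolding R_def by auto
  then have "\<exists>F. \<forall>n. F n \<in> {y. asc lt Q y} \<and> R (F n) (F (Suc n))"
    using a by (intro successor_sequence) auto
  then obtain F where F: "\<And>n. asc lt Q (F n)" "\<And>n. R (F n) (F (Suc n))" by auto
  \<comment> \<open>\<open>F n (k n)\<close> witnesses that the down-closure shrinks at step
    \<open>n\<close>; it stays outside all later down-closures.\<close>
  obtain k where k: "\<And>n j. \<not> F n (k n) \<sqsubset> F (Suc n) j"
    using F(2) unfolding R_def by metis
  have FS: "F n i \<sqsubset> F n (Suc i)" "F n i \<in> Q" for n i using F(1)[of n] by (auto simp: asc_def)
  have dom: "\<exists>j. F (n + m) i \<sqsubset> F n j" for n m i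
  proof (induction m arbitrary: i)
    case 0
    then show ?case using FS by auto
  next
    case (Suc m)
    obtain j where "F (Suc (n + m)) i \<sqsubset> F (n + m) j" using F(2) unfolding R_def by blast
    then show ?case using Suc trans by (metis add_Suc_right)
  qed
  have k_later: "\<not> F n (k n) \<sqsubset> F m j" if "n < m" for n m j
  proof -
    obtain l where "m = Suc n + l" using \<open>n < m\<close> by (metis less_iff_Suc_add add_Suc)
    then obtain j' where "F m j \<sqsubset> F (Suc n) j'" using dom by blast
    then show ?thesis using k trans by blast
  qed
  \<comment> \<open>Choosing an index at least \<open>k m\<close> keeps \<open>x m\<close> from
    lying under later terms; going far enough along \<open>F m\<close> keeps it from lying under
    earlier ones, which is possible as only finitely many terms lie below a given point of
    \<open>Q\<close>.\<close>
  have "\<exists>x. \<forall>m. (\<exists>i\<ge>k m. x m = F m i) \<and> (\<forall>s\<in>x ` {..<m} \<inter> Q. \<not> x m \<sqsubset> s)"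
  proof (rule finite_history_choice)
    fix m and S :: "'a set" assume S: "finite S"
    have "finite {i. F m i \<sqsubset> s}" if s: "s \<in> Q" for s
    proof (rule ccontr)
      assume inf: "infinite {i. F m i \<sqsubset> s}"
      have "F m i \<sqsubset> s" for i
      proof -
        obtain j where "j > i" "F m j \<sqsubset> s"
          using inf infinite_nat_iff_unbounded[of "{i. F m i \<sqsubset> s}"] by auto
        then show ?thesis using asc_less[OF F(1)] trans by blast
      qed
      then have "asc lt (oi lt (F m 0) s) (\<lambda>i. F m (i + Suc 0))"
        using asc_shift[OF F(1)[of m], of "Suc 0"] asc_less[OF F(1)[of m]] by (auto simp: asc_def oi_def)
      then have "infinite (oi lt (F m 0) s)" by (rule asc_infinite)
      then show False using Q(2) FS(2) s by blast
    qed
    then have "finite ({..<k m} \<union> (\<Union>s\<in>S \<inter> Q. {i. F m i \<sqsubset> s}))" using S by simp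
    then obtain i where "i \<notin> {..<k m} \<union> (\<Union>s\<in>S \<inter> Q. {i. F m i \<sqsubset> s})"
      using ex_new_if_finite[OF infinite_UNIV_nat] by blast
    then show "\<exists>x. (\<exists>i\<ge>k m. x = F m i) \<and> (\<forall>s\<in>S \<inter> Q. \<not> x \<sqsubset> s)"
      by (intro exI[of _ "F m i"]) (auto simp: not_less)
  qed
  then obtain x where x: "\<And>m. \<exists>i\<ge>k m. x m = F m i" "\<And>m s. s \<in> x ` {..<m} \<inter> Q \<Longrightarrow> \<not> x m \<sqsubset> s"
    by blast
  have xQ: "x m \<in> Q" for m using x(1)[of m] FS(2) by auto
  have up: "\<not> (x n = x m \<or> x n \<sqsubset> x m)" if "n < m" for n m
  proof
    assume a: "x n = x m \<or> x n \<sqsubset> x m"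
    obtain i where i: "i \<ge> k n" "x n = F n i" using x(1) by blast
    obtain j where j: "x m = F m j" using x(1) by blast
    have "F n (k n) = x n \<or> F n (k n) \<sqsubset> x n"
      using i asc_less[OF F(1), of "k n" i] by (cases "k n = i") auto
    then have "F n (k n) \<sqsubset> F m (Suc j)"
      using a j FS(1)[of m j] trans by metis
    then show False using k_later that by blast
  qed
  have down: "\<not> x m \<sqsubset> x n" if "n < m" for n m
    using x(2)[of "x n" m] that xQ by auto
  have "inj x" by (rule injI) (metis up linorder_neqE_nat)
  then have "infinite (range x)" using range_inj_infinite by blast
  moreover have "range x \<subseteq> P" using xQ Q(1) by blast
  ultimately obtain n m where "x n \<sqsubset> x m" using fac[of "range x"] by blast
  then show False using up down irrefl by (metis linorder_neqE_nat)
qed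

lemma minimal_desc:
  assumes "Q \<subseteq> P" "\<And>x y. x \<in> Q \<Longrightarrow> y \<in> Q \<Longrightarrow> finite (oi lt x y)" "asc lt\<inverse>\<inverse> Q a"
  shows "\<exists>y. asc lt\<inverse>\<inverse> Q y \<and> (\<forall>z. asc lt\<inverse>\<inverse> Q z \<longrightarrow> (\<forall>i. \<exists>j. y j \<sqsubset> z i) \<longrightarrow> (\<forall>i. \<exists>j. z j \<sqsubset> y i))"
proof -
  interpret d: vac_order "lt\<inverse>\<inverse>" P by (rule vac_dual)
  show ?thesis using d.minimal_asc[of Q a] assms by simp
qed

text \<open>The points with finitely many predecessors have finite intervals and no descending
  sequence. The part of \<open>T\<close> below a minimal ascending sequence of them is a region:
  minimality makes every ascending sequence in it cofinal, and as a down-set of \<open>T\<close> it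
  leaves nothing to absorb.\<close>

lemma initial_region:
  assumes T: "ordconvex lt T" "T \<subseteq> P" and inf: "infinite {x \<in> T. finite {z \<in> T. z \<sqsubset> x}}"
  shows "\<exists>Q. region_family lt T {Q}"
proof -
  define D where "D = {x \<in> T. finite {z \<in> T. z \<sqsubset> x}}"
  have D: "D \<subseteq> P" using T by (auto simp: D_def)
  have fin: "finite (oi lt x y)" if "x \<in> D" "y \<in> D" for x y
  proof (rule finite_subset)
    show "oi lt x y \<subseteq> {z \<in> T. z \<sqsubset> y}"
      using T(1) that by (auto simp: D_def oi_def intro: ordconvexD)
    show "finite {z \<in> T. z \<sqsubset> y}" using that by (simp add: D_def)
  qed
  have nodesc: "\<not> asc lt\<inverse>\<inverse> D d" for d
  proof
    assume d: "asc lt\<inverse>\<inverse> D d"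
    have "asc lt\<inverse>\<inverse> {z \<in> T. z \<sqsubset> d 0} (\<lambda>i. d (i + Suc 0))"
      using asc_shift[OF d, of "Suc 0"] desc_less[OF d] by (auto simp: asc_def D_def)
    then have "infinite {z \<in> T. z \<sqsubset> d 0}" by (rule desc_infinite)
    then show False using d by (auto simp: asc_def D_def)
  qed
  then obtain a where "asc lt D a"
    using infinite_asc_or_desc[OF D] inf by (auto simp: D_def)
  then obtain y where y: "asc lt D y"
    "\<And>z i. asc lt D z \<Longrightarrow> (\<forall>i. \<exists>j. z i \<sqsubset> y j) \<Longrightarrow> \<exists>j. y i \<sqsubset> z j"
    using minimal_asc[OF D fin] by blast
  define J where "J = {x \<in> T. \<exists>i. x \<sqsubset> y i}"
  have JD: "J \<subseteq> D"
  proof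
    fix x assume "x \<in> J"
    then obtain i where i: "x \<in> T" "x \<sqsubset> y i" by (auto simp: J_def)
    have "{z \<in> T. z \<sqsubset> x} \<subseteq> {z \<in> T. z \<sqsubset> y i}" using i trans by blast
    moreover have "finite {z \<in> T. z \<sqsubset> y i}" using y(1) by (auto simp: asc_def D_def)
    ultimately show "x \<in> D" using i finite_subset by (auto simp: D_def)
  qed
  have yJ: "asc lt J y" using y(1) by (auto simp: asc_def J_def D_def)
  have "star lt J"
    unfolding star_def
  proof (intro conjI allI impI ballI)
    fix z x assume z: "asc lt J z" and x: "x \<in> J"
    have "asc lt D z" using z JD by (rule asc_subset)
    moreover have "\<forall>i. \<exists>j. z i \<sqsubset> y j" using z by (auto simp: asc_def J_def)
    ultimately have "\<exists>j. y i \<sqsubset> z j" for i using y(2) by blast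
    then show "\<exists>i. x \<sqsubset> z i" using x trans unfolding J_def by blast
  next
    fix z x assume "asc lt\<inverse>\<inverse> J z"
    then have "asc lt\<inverse>\<inverse> D z" using JD by (rule asc_subset)
    then show "\<exists>i. z i \<sqsubset> x" using nodesc by blast
  qed
  moreover have "J \<noteq> {}" using yJ by (auto simp: asc_def)
  moreover have "\<not> noasc lt J" using yJ by (auto simp: noasc_def)
  ultimately have "region_family lt T {J}"
    by (intro singleton_region_family) (auto simp: J_def intro: trans)
  then show ?thesis by blast
qed

text \<open>The same cut, made at both ends of the union \<open>K\<close> of the finite
  intervals.\<close>

lemma discrete_pair_region:
  assumes T: "ordconvex lt T" "T \<subseteq> P" and da: "discrete_pair lt T d a"
  shows "\<exists>Q. region_family lt T {Q}"
proof -
  have d: "asc lt\<inverse>\<inverse> T d" and a: "asc lt T a" and "d 0 \<sqsubset> a 0"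
    and fin: "\<And>i j. finite (oi lt (d i) (a j))"
    using da by (auto simp: discrete_pair_def)
  have dS: "d (Suc i) \<sqsubset> d i" "d i \<in> T" and aS: "a i \<sqsubset> a (Suc i)" "a i \<in> T" for i
    using d a by (auto simp: asc_def)
  define K where "K = {x. \<exists>i j. d i \<sqsubset> x \<and> x \<sqsubset> a j}"
  have KT: "K \<subseteq> T" using T(1) dS(2) aS(2) unfolding K_def by (blast intro: ordconvexD)
  then have KP: "K \<subseteq> P" using T(2) by blast
  have finK: "finite (oi lt x y)" if "x \<in> K" "y \<in> K" for x y
  proof -
    obtain i j where "d i \<sqsubset> x" "y \<sqsubset> a j" using \<open>x \<in> K\<close> \<open>y \<in> K\<close> by (auto simp: K_def)
    then have "oi lt x y \<subseteq> oi lt (d i) (a j)" by (intro oi_mono) auto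
    then show ?thesis using fin finite_subset by blast
  qed
  have d0a: "d 0 \<sqsubset> a j" for j
    using \<open>d 0 \<sqsubset> a 0\<close> asc_less[OF a, of 0 j] trans by (cases j) auto
  have da': "d i \<sqsubset> a j" for i j
    using d0a[of j] desc_less[OF d, of 0 i] trans by (cases i) auto
  have "asc lt K a" using da' aS by (auto simp: asc_def K_def)
  then obtain y where y: "asc lt K y"
    "\<And>z i. asc lt K z \<Longrightarrow> (\<forall>i. \<exists>j. z i \<sqsubset> y j) \<Longrightarrow> \<exists>j. y i \<sqsubset> z j"
    using minimal_asc[OF KP finK] by blast
  have yS: "y i \<sqsubset> y (Suc i)" "y i \<in> K" for i using y(1) by (auto simp: asc_def)
  \<comment> \<open>The upper end is trimmed first, then the lower one inside \<open>L\<close>. The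
    second cut is harmless to the first, as an ascending sequence in \<open>Q\<close> is still one
    in \<open>K\<close>, where \<open>y\<close> is minimal.\<close>
  define L where "L = {x \<in> K. \<exists>i. x \<sqsubset> y i}"
  have LK: "L \<subseteq> K" by (auto simp: L_def)
  have LP: "L \<subseteq> P" using KP LK by blast
  have finL: "finite (oi lt x y)" if "x \<in> L" "y \<in> L" for x y using finK that LK by blast
  obtain k where k: "d k \<sqsubset> y 0" using yS(2)[of 0] by (auto simp: K_def)
  have "d i \<in> K" for i using da' dS unfolding K_def by blast
  moreover have "d (i + k) \<sqsubset> y 0" for i
    using k desc_less[OF d, of k "i + k"] trans by (cases i) auto
  ultimately have "asc lt\<inverse>\<inverse> L (\<lambda>i. d (i + k))" using dS by (auto simp: asc_def L_def)
  then obtain w where w: "asc lt\<inverse>\<inverse> L w"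
    "\<And>z i. asc lt\<inverse>\<inverse> L z \<Longrightarrow> (\<forall>i. \<exists>j. w j \<sqsubset> z i) \<Longrightarrow> \<exists>j. z j \<sqsubset> w i"
    using minimal_desc[OF LP finL] by blast
  have wS: "w (Suc i) \<sqsubset> w i" "w i \<in> L" for i using w(1) by (auto simp: asc_def)
  define Q where "Q = {x \<in> L. \<exists>i. w i \<sqsubset> x}"
  have QL: "Q \<subseteq> L" by (auto simp: Q_def)
  have QK: "Q \<subseteq> K" using QL LK by blast
  obtain m where m: "w 0 \<sqsubset> y m" using wS(2)[of 0] by (auto simp: L_def)
  have "w 0 \<sqsubset> y (i + m)" for i
    using m asc_less[OF y(1), of m "i + m"] trans by (cases i) auto
  then have yQ: "asc lt Q (\<lambda>i. y (i + m))"
    using yS by (auto simp: asc_def Q_def L_def)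
  have wQ: "asc lt\<inverse>\<inverse> Q w" using wS by (auto simp: asc_def Q_def)
  have "star lt Q"
    unfolding star_def
  proof (intro conjI allI impI ballI)
    fix z x assume z: "asc lt Q z" and x: "x \<in> Q"
    have "asc lt K z" using z QK by (rule asc_subset)
    moreover have "\<forall>i. \<exists>j. z i \<sqsubset> y j" using z by (auto simp: asc_def Q_def L_def)
    ultimately have "\<exists>j. y i \<sqsubset> z j" for i using y(2) by blast
    then show "\<exists>i. x \<sqsubset> z i" using x trans unfolding Q_def L_def by blast
  next
    fix z x assume z: "asc lt\<inverse>\<inverse> Q z" and x: "x \<in> Q"
    have "asc lt\<inverse>\<inverse> L z" using z QL by (rule asc_subset)
    moreover have "\<forall>i. \<exists>j. w j \<sqsubset> z i" using z by (auto simp: asc_def Q_def)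
    ultimately have "\<exists>j. z j \<sqsubset> w i" for i using w(2) by blast
    then show "\<exists>i. z i \<sqsubset> x" using x trans unfolding Q_def by blast
  qed
  moreover have "Q \<noteq> {}" using wQ by (auto simp: asc_def)
  moreover have "\<not> noasc lt Q" "\<not> noasc lt\<inverse>\<inverse> Q" using yQ wQ by (auto simp: noasc_def)
  moreover have "x \<in> Q" if xq: "q \<in> Q" "x \<sqsubset> q" "q' \<in> Q" "q' \<sqsubset> x" for x q q'
  proof -
    have "x \<in> K" using xq QK trans unfolding K_def by blast
    then show ?thesis using xq trans unfolding Q_def L_def by blast
  qed
  ultimately have "region_family lt T {Q}"
    using QK KT by (intro singleton_region_family) auto
  then show ?thesis by blast
qed

end

section \<open>Dense suborders\<close>

definition nonscattered :: "('a \<Rightarrow> 'a \<Rightarrow> bool) \<Rightarrow> 'a set \<Rightarrow> bool" where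
  "nonscattered lt X \<longleftrightarrow> (\<exists>S\<subseteq>X. (\<exists>x\<in>S. \<exists>y\<in>S. lt x y) \<and>
     (\<forall>x\<in>S. \<forall>y\<in>S. lt x y \<longrightarrow> (\<exists>z\<in>S. lt x z \<and> lt z y)))"

lemma nonscattered_mono: "nonscattered lt X \<Longrightarrow> X \<subseteq> Y \<Longrightarrow> nonscattered lt Y"
  unfolding nonscattered_def by (elim exE conjE, rule exI) (intro conjI; simp; blast)

context vac_order
begin

lemma nonscattered_oi:
  assumes "\<forall>x\<in>S. \<forall>y\<in>S. x \<sqsubset> y \<longrightarrow> (\<exists>z\<in>S. x \<sqsubset> z \<and> z \<sqsubset> y)"
    and "u \<in> S" "v \<in> S" "u \<sqsubset> v"
  shows "nonscattered lt (S \<inter> oi lt u v)"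
proof -
  let ?S = "S \<inter> oi lt u v"
  obtain z where z: "z \<in> S" "u \<sqsubset> z" "z \<sqsubset> v" using assms by blast
  obtain w where w: "w \<in> S" "u \<sqsubset> w" "w \<sqsubset> z" using assms z by blast
  have "w \<sqsubset> v" using z w trans by blast
  then have "w \<in> ?S" "z \<in> ?S" using z w by (auto simp: oi_def)
  moreover have "\<exists>z\<in>?S. x \<sqsubset> z \<and> z \<sqsubset> y" if xy: "x \<in> ?S" "y \<in> ?S" "x \<sqsubset> y" for x y
  proof -
    obtain z where "z \<in> S" "x \<sqsubset> z" "z \<sqsubset> y" using assms(1) xy by blast
    then show ?thesis using xy trans unfolding oi_def by blast
  qed
  ultimately show ?thesis using w(3) unfolding nonscattered_def by blast
qed

text \<open>Indecomposability, as for the rationals: either some interval of the dense set avoids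
  \<open>A\<close> and thus lies in \<open>B\<close>, or \<open>A\<close> meets all of them and
  inherits density.\<close>

lemma nonscattered_Un:
  assumes "nonscattered lt (A \<union> B)"
  shows "nonscattered lt A \<or> nonscattered lt B"
proof -
  obtain S where S: "S \<subseteq> A \<union> B" "\<exists>x\<in>S. \<exists>y\<in>S. x \<sqsubset> y"
    and dense: "\<forall>x\<in>S. \<forall>y\<in>S. x \<sqsubset> y \<longrightarrow> (\<exists>z\<in>S. x \<sqsubset> z \<and> z \<sqsubset> y)"
    using assms unfolding nonscattered_def by blast
  show ?thesis
  proof (cases "\<exists>x\<in>S. \<exists>y\<in>S. x \<sqsubset> y \<and> A \<inter> S \<inter> oi lt x y = {}")
    case True
    then obtain x y where xy: "x \<in> S" "y \<in> S" "x \<sqsubset> y" "A \<inter> S \<inter> oi lt x y = {}" by blast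
    then have "S \<inter> oi lt x y \<subseteq> B" using S(1) by blast
    then show ?thesis using nonscattered_mono[OF nonscattered_oi[OF dense xy(1-3)]] by blast
  next
    case False
    then have A: "\<exists>z\<in>A \<inter> S. x \<sqsubset> z \<and> z \<sqsubset> y" if "x \<in> S" "y \<in> S" "x \<sqsubset> y" for x y
      using that unfolding oi_def by blast
    obtain x y where "x \<in> S" "y \<in> S" "x \<sqsubset> y" using S(2) by blast
    with A obtain z where z: "z \<in> A \<inter> S" "x \<sqsubset> z" "z \<sqsubset> y" by blast
    with A \<open>y \<in> S\<close> obtain w where "w \<in> A \<inter> S" "z \<sqsubset> w" by blast
    then have "nonscattered lt A"
      unfolding nonscattered_def using z(1) A by (intro exI[of _ "A \<inter> S"]) blast
    then show ?thesis ..
  qed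
qed

text \<open>A maximal \<open>E\<close>-chain is dense: a point \<open>E\<close>-between two
  neighbours would by transitivity be \<open>E\<close>-comparable to the whole chain and hence
  belong to it.\<close>

lemma maximal_dense_chain:
  assumes tr: "\<And>x y z. E x y \<Longrightarrow> E y z \<Longrightarrow> E x z" and E: "\<And>x y. E x y \<Longrightarrow> x \<sqsubset> y"
    and dense: "\<And>x y. E x y \<Longrightarrow> \<exists>z. E x z \<and> E z y" and xy: "E x0 y0"
  obtains S where "x0 \<in> S" "y0 \<in> S" "\<forall>x\<in>S. \<forall>y\<in>S. x = y \<or> E x y \<or> E y x"
    "\<forall>z. (\<forall>t\<in>S. t = z \<or> E t z \<or> E z t) \<longrightarrow> z \<in> S"
    "\<forall>x\<in>S. \<forall>y\<in>S. x \<sqsubset> y \<longrightarrow> (\<exists>z\<in>S. x \<sqsubset> z \<and> z \<sqsubset> y)"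
proof -
  define \<C> where "\<C> = {S. x0 \<in> S \<and> y0 \<in> S \<and> (\<forall>x\<in>S. \<forall>y\<in>S. x = y \<or> E x y \<or> E y x)}"
  have "\<exists>M\<in>\<C>. \<forall>X\<in>\<C>. M \<subseteq> X \<longrightarrow> X = M"
  proof (rule subset_Zorn_nonempty)
    show "\<C> \<noteq> {}" using xy by (auto simp: \<C>_def intro!: exI[of _ "{x0, y0}"])
    fix \<D> assume D: "\<D> \<noteq> {}" "subset.chain \<C> \<D>"
    have sub: "\<D> \<subseteq> \<C>" using D(2) by (simp add: subset_chain_def)
    have "x = y \<or> E x y \<or> E y x" if xy: "x \<in> \<Union>\<D>" "y \<in> \<Union>\<D>" for x y
    proof -
      obtain X Y where XY: "X \<in> \<D>" "Y \<in> \<D>" "x \<in> X" "y \<in> Y" using xy by blast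
      then have "X \<subseteq> Y \<or> Y \<subseteq> X" using D(2) by (auto simp: subset_chain_def)
      then obtain Z where "Z \<in> \<D>" "x \<in> Z" "y \<in> Z" using XY by blast
      then show ?thesis using sub by (auto simp: \<C>_def)
    qed
    then show "\<Union>\<D> \<in> \<C>" using D(1) sub by (auto simp: \<C>_def)
  qed
  then obtain S where S: "S \<in> \<C>" and mx: "\<And>X. X \<in> \<C> \<Longrightarrow> S \<subseteq> X \<Longrightarrow> X = S" by blast
  have ch: "x = y \<or> E x y \<or> E y x" if "x \<in> S" "y \<in> S" for x y
    using S that by (auto simp: \<C>_def)
  have mz: "z \<in> S" if z: "\<And>t. t \<in> S \<Longrightarrow> t = z \<or> E t z \<or> E z t" for z
  proof -
    have "insert z S \<in> \<C>" using S z by (auto simp: \<C>_def)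
    then show ?thesis using mx by blast
  qed
  have between: "\<exists>z\<in>S. x \<sqsubset> z \<and> z \<sqsubset> y" if "x \<in> S" "y \<in> S" "x \<sqsubset> y" for x y
  proof (rule ccontr)
    assume no: "\<not> ?thesis"
    have "E x y" using ch[OF that(1,2)] that(3) E asym irrefl by blast
    then obtain z where z: "E x z" "E z y" using dense by blast
    have "t = z \<or> E t z \<or> E z t" if "t \<in> S" for t
    proof -
      have "t = x \<or> E t x \<or> E x t" "t = y \<or> E t y \<or> E y t"
        using ch that \<open>x \<in> S\<close> \<open>y \<in> S\<close> by blast+
      moreover have "\<not> (E x t \<and> E t y)" using no that E by blast
      ultimately show ?thesis using z tr by metis
    qed
    then have "z \<in> S" using mz by blast
    then show False using no z E by blast
  qed
  have "x0 \<in> S" "y0 \<in> S" using S by (auto simp: \<C>_def)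
  then show ?thesis using ch mz between by (intro that[of S]) auto
qed

end

section \<open>Families in gaps\<close>

text \<open>The place that \<open>\<Q>\<close> leaves around \<open>p\<close>. It is meant for
  \<open>p\<close> lying above or below each region, and then no region of \<open>\<Q>\<close> meets
  it.\<close>

definition gap :: "('a \<Rightarrow> 'a \<Rightarrow> bool) \<Rightarrow> 'a set \<Rightarrow> 'a set set \<Rightarrow> 'a \<Rightarrow> 'a set" where
  "gap lt P \<Q> p = {x \<in> P. \<forall>R\<in>\<Q>. (below lt R {p} \<longrightarrow> below lt R {x}) \<and> (below lt {p} R \<longrightarrow> below lt {x} R)}"

lemma gap_conversep [simp]: "gap lt\<inverse>\<inverse> P \<Q> p = gap lt P \<Q> p"
  by (auto simp: gap_def)

lemma compat_subset: "compat lt \<Q>' Q x \<Longrightarrow> \<Q> \<subseteq> \<Q>' \<Longrightarrow> compat lt \<Q> Q x"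
  unfolding compat_def by blast

context vac_order
begin

lemma below_trans: "below lt A B \<Longrightarrow> below lt B C \<Longrightarrow> B \<noteq> {} \<Longrightarrow> below lt A C"
  unfolding below_def using trans by blast

lemma below_antisym: "below lt A B \<Longrightarrow> A \<noteq> {} \<Longrightarrow> B \<noteq> {} \<Longrightarrow> \<not> below lt B A"
  unfolding below_def using asym by blast

lemma ordconvex_oi: "ordconvex lt (oi lt x y)"
  unfolding ordconvex_def oi_def using trans by blast

lemma ordconvex_lower: "ordconvex lt T \<Longrightarrow> ordconvex lt {y \<in> T. y \<sqsubset> c}"
  unfolding ordconvex_def oi_def using trans by blast

section \<open>Scattered convex sets\<close>

lemma final_region:
  assumes "ordconvex lt T" "T \<subseteq> P" "infinite {x \<in> T. finite {z \<in> T. x \<sqsubset> z}}"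
  shows "\<exists>Q. region_family lt T {Q}"
proof -
  interpret d: vac_order "lt\<inverse>\<inverse>" P by (rule vac_dual)
  show ?thesis using d.initial_region[of T] assms by simp
qed

lemma finite_nodesc: "finite X \<Longrightarrow> noasc lt\<inverse>\<inverse> X"
  using desc_infinite by (auto simp: noasc_def)

text \<open>Without a descending sequence there would be a minimal point \<open>m\<close> with
  infinitely many predecessors; these all have finitely many predecessors, and only finitely many
  such points exist.\<close>

lemma infinite_below_desc:
  assumes T: "ordconvex lt T" "T \<subseteq> P" and fin: "finite {x \<in> T. finite {z \<in> T. z \<sqsubset> x}}"
    and inf: "infinite {z \<in> T. z \<sqsubset> x}"
  shows "\<not> noasc lt\<inverse>\<inverse> {z \<in> T. z \<sqsubset> x}"
proof
  assume n: "noasc lt\<inverse>\<inverse> {z \<in> T. z \<sqsubset> x}"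
  let ?D = "{x \<in> T. finite {z \<in> T. z \<sqsubset> x}}"
  have "{z \<in> T. z \<sqsubset> x} \<subseteq> ?D"
  proof (rule ccontr)
    assume "\<not> ?thesis"
    then obtain b where "b \<in> {z \<in> T. z \<sqsubset> x} - ?D" by blast
    moreover have "noasc lt\<inverse>\<inverse> ({z \<in> T. z \<sqsubset> x} - ?D)" using n by (rule noasc_subset) blast
    ultimately obtain m where m: "m \<in> {z \<in> T. z \<sqsubset> x} - ?D"
      "\<forall>y\<in>{z \<in> T. z \<sqsubset> x} - ?D. \<not> y \<sqsubset> m"
      using nodesc_minimal by blast
    then have "{z \<in> T. z \<sqsubset> m} \<subseteq> ?D" using trans by blast
    then have "finite {z \<in> T. z \<sqsubset> m}" using fin finite_subset by blast
    then show False using m(1) by blast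
  qed
  then show False using fin inf finite_subset by blast
qed

lemma infinite_above_asc:
  assumes "ordconvex lt T" "T \<subseteq> P" "finite {x \<in> T. finite {z \<in> T. x \<sqsubset> z}}"
    and "infinite {z \<in> T. x \<sqsubset> z}"
  shows "\<not> noasc lt {z \<in> T. x \<sqsubset> z}"
proof -
  interpret d: vac_order "lt\<inverse>\<inverse>" P by (rule vac_dual)
  show ?thesis using d.infinite_below_desc[of T x] assms by simp
qed

text \<open>If splitting can always be repeated on both sides of a suitable point, the relation "the
  interval contains a splitting point" is dense, and a maximal chain for it is a dense
  suborder.\<close>

lemma double_splits_nonscattered:
  assumes T: "ordconvex lt T" and c0: "splits lt T c0"
    and double: "\<And>I c. ordconvex lt I \<Longrightarrow> I \<subseteq> T \<Longrightarrow> splits lt I c \<Longrightarrow>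
      \<exists>c\<in>I. (\<exists>x. splits lt {y \<in> I. y \<sqsubset> c} x) \<and> (\<exists>x. splits lt {y \<in> I. c \<sqsubset> y} x)"
  shows "nonscattered lt T"
proof -
  define E where "E u v \<longleftrightarrow> u \<in> T \<and> v \<in> T \<and> u \<sqsubset> v \<and> (\<exists>x. splits lt (oi lt u v) x)" for u v
  have tr: "E u w" if "E u v" "E v w" for u v w
  proof -
    have "u \<sqsubset> w" using that trans unfolding E_def by blast
    moreover have "oi lt u v \<subseteq> oi lt u w" using that by (intro oi_mono) (auto simp: E_def)
    then have "\<exists>x. splits lt (oi lt u w) x" using that(1) splits_mono[of lt "oi lt u v"] unfolding E_def by meson
    ultimately show ?thesis using that unfolding E_def by blast
  qed
  have dense: "\<exists>z. E u z \<and> E z v" if uv: "E u v" for u v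
  proof -
    let ?I = "oi lt u v"
    have sub: "?I \<subseteq> T" using T uv by (auto simp: E_def ordconvex_def)
    obtain c where c: "c \<in> ?I" "\<exists>x. splits lt {y \<in> ?I. y \<sqsubset> c} x" "\<exists>x. splits lt {y \<in> ?I. c \<sqsubset> y} x"
      using double[OF ordconvex_oi sub] uv unfolding E_def by blast
    have "{y \<in> ?I. y \<sqsubset> c} = oi lt u c" "{y \<in> ?I. c \<sqsubset> y} = oi lt c v"
      using c(1) trans unfolding oi_def by blast+
    then have "E u c" "E c v" using c sub uv unfolding E_def oi_def by auto
    then show ?thesis by blast
  qed
  \<comment> \<open>Two applications give the first related pair: \<open>c\<close> has a splittable
    part below it, and inside that part \<open>e\<close> has a splittable part above it, which is
    the interval from \<open>e\<close> to \<open>c\<close>.\<close>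
  obtain c where c: "c \<in> T" "\<exists>x. splits lt {y \<in> T. y \<sqsubset> c} x"
    using double[OF T order_refl c0] by blast
  obtain e where e: "e \<in> {y \<in> T. y \<sqsubset> c}" "\<exists>x. splits lt {y \<in> {y \<in> T. y \<sqsubset> c}. e \<sqsubset> y} x"
    using double[OF ordconvex_lower[OF T, of c]] c by blast
  have "{y \<in> {y \<in> T. y \<sqsubset> c}. e \<sqsubset> y} = oi lt e c"
    using T c(1) e(1) unfolding ordconvex_def oi_def by blast
  then have "E e c" using c e unfolding E_def by auto
  have E_lt: "u \<sqsubset> v" if "E u v" for u v using that by (simp add: E_def)
  obtain S where S: "e \<in> S" "c \<in> S" "\<forall>x\<in>S. \<forall>y\<in>S. x = y \<or> E x y \<or> E y x"
       "\<forall>z. (\<forall>t\<in>S. t = z \<or> E t z \<or> E z t) \<longrightarrow> z \<in> S"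
       "\<forall>x\<in>S. \<forall>y\<in>S. x \<sqsubset> y \<longrightarrow> (\<exists>z\<in>S. x \<sqsubset> z \<and> z \<sqsubset> y)"
    by (rule maximal_dense_chain[of E, OF tr E_lt dense \<open>E e c\<close>])
  have "x \<in> T" if "x \<in> S" for x
    using S(3)[rule_format, OF S(1) that] e(1) by (auto simp: E_def)
  then have "S \<subseteq> T" by blast
  moreover have "\<exists>x\<in>S. \<exists>y\<in>S. x \<sqsubset> y" using S(1,2) e(1) by blast
  ultimately show ?thesis using S(5) unfolding nonscattered_def by (intro exI[of _ S]) blast
qed

text \<open>A finite set is a region, and an infinite beginning or end yields one directly.
  Otherwise some point splits \<open>T\<close>, and since \<open>T\<close> is scattered the
  splitting fails to repeat on both sides inside some convex \<open>I\<close>; there a discrete pair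
  exists.\<close>

lemma scattered_region_family:
  assumes T: "ordconvex lt T" "T \<subseteq> P" "T \<noteq> {}" and sc: "\<not> nonscattered lt T"
  shows "\<exists>\<Q>. \<Q> \<noteq> {} \<and> region_family lt T \<Q>"
proof -
  let ?D = "{x \<in> T. finite {z \<in> T. z \<sqsubset> x}}" and ?E = "{x \<in> T. finite {z \<in> T. x \<sqsubset> z}}"
  consider "finite T" | "infinite ?D" | "infinite ?E" | "infinite T" "finite ?D" "finite ?E" by blast
  then have "\<exists>Q. region_family lt T {Q}"
  proof cases
    case 1
    then have "star lt T"
      using finite_noasc[of T] finite_nodesc[of T] by (auto simp: star_def noasc_def)
    then have "region_family lt T {T}" using T(3) by (intro singleton_region_family) auto
    then show ?thesis by blast
  next
    case 2
    then show ?thesis using initial_region T by blast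
  next
    case 3
    then show ?thesis using final_region T by blast
  next
    case 4
    then have "\<not> T \<subseteq> ?D \<union> ?E" using finite_subset[of T "?D \<union> ?E"] by blast
    then obtain x where x: "x \<in> T" "infinite {z \<in> T. z \<sqsubset> x}" "infinite {z \<in> T. x \<sqsubset> z}" by blast
    then have "splits lt T x"
      using infinite_below_desc[OF T(1,2) 4(2)] infinite_above_asc[OF T(1,2) 4(3)] by (simp add: splits_def)
    then obtain I c where I: "ordconvex lt I" "I \<subseteq> T" "splits lt I c"
      and single: "\<not> (\<exists>c\<in>I. (\<exists>x. splits lt {y \<in> I. y \<sqsubset> c} x) \<and> (\<exists>x. splits lt {y \<in> I. c \<sqsubset> y} x))"
      using double_splits_nonscattered[OF T(1)] sc by blast
    have "I \<subseteq> P" using I T by blast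
    then obtain d a where "discrete_pair lt I d a"
      using discrete_pair_exists[OF I(1) _ I(3)] single by blast
    \<comment> \<open>\<open>oi\<close> is taken in the whole order, so the finiteness of the
      intervals does not depend on \<open>I\<close>.\<close>
    then have "discrete_pair lt T d a"
      using asc_subset[OF _ I(2)] by (auto simp: discrete_pair_def)
    then show ?thesis using discrete_pair_region T by blast
  qed
  then show ?thesis by blast
qed

section \<open>Convex sets with a dense suborder\<close>

definition incomparable_part :: "'a set \<Rightarrow> 'a set \<Rightarrow> 'a set" where
  "incomparable_part T A = {x \<in> T. \<forall>a\<in>A. x \<noteq> a \<and> \<not> x \<sqsubset> a \<and> \<not> a \<sqsubset> x}"

lemma maximal_antichain_nonscattered:
  assumes T: "T \<subseteq> P" "nonscattered lt T"
  shows "\<exists>A. nonscattered lt (incomparable_part T A) \<and>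
     (\<forall>s\<in>incomparable_part T A. \<not> nonscattered lt (incomparable_part T (insert s A)))"
proof -
  define \<C> where "\<C> = {A. A \<subseteq> T \<and> (\<forall>x\<in>A. \<forall>y\<in>A. \<not> x \<sqsubset> y) \<and> nonscattered lt (incomparable_part T A)}"
  have "\<exists>M\<in>\<C>. \<forall>X\<in>\<C>. M \<subseteq> X \<longrightarrow> X = M"
  proof (rule subset_Zorn_nonempty)
    show "\<C> \<noteq> {}" using T(2) by (auto simp: \<C>_def incomparable_part_def intro!: exI[of _ "{}"])
    fix \<D> assume D: "\<D> \<noteq> {}" "subset.chain \<C> \<D>"
    have sub: "\<D> \<subseteq> \<C>" using D(2) by (simp add: subset_chain_def)
    have "\<not> x \<sqsubset> y" if xy: "x \<in> \<Union>\<D>" "y \<in> \<Union>\<D>" for x y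
    proof -
      obtain X Y where XY: "X \<in> \<D>" "Y \<in> \<D>" "x \<in> X" "y \<in> Y" using xy by blast
      then have "X \<subseteq> Y \<or> Y \<subseteq> X" using D(2) by (auto simp: subset_chain_def)
      then obtain Z where "Z \<in> \<D>" "x \<in> Z" "y \<in> Z" using XY by blast
      then show ?thesis using sub by (auto simp: \<C>_def)
    qed
    moreover have UT: "\<Union>\<D> \<subseteq> T" using sub by (auto simp: \<C>_def)
    \<comment> \<open>The union is an antichain, hence finite and therefore itself a member of the
      chain; \<open>nonscattered\<close> need not be carried through a limit.\<close>
    ultimately have "finite (\<Union>\<D>)" using fac[of "\<Union>\<D>"] T(1) by blast
    then obtain Z where "Z \<in> \<D>" "\<Union>\<D> \<subseteq> Z"
      using finite_subset_Union_chain[OF _ order_refl D] by blast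
    then have "\<Union>\<D> = Z" by blast
    then show "\<Union>\<D> \<in> \<C>" using \<open>Z \<in> \<D>\<close> sub by blast
  qed
  then obtain A where A: "A \<in> \<C>" and mx: "\<And>X. X \<in> \<C> \<Longrightarrow> A \<subseteq> X \<Longrightarrow> X = A" by blast
  have "\<not> nonscattered lt (incomparable_part T (insert s A))" if s: "s \<in> incomparable_part T A" for s
  proof
    assume "nonscattered lt (incomparable_part T (insert s A))"
    then have "insert s A \<in> \<C>" using A s irrefl by (auto simp: \<C>_def incomparable_part_def)
    then have "s \<in> A" using mx by blast
    then show False using s by (auto simp: incomparable_part_def)
  qed
  then show ?thesis using A by (auto simp: \<C>_def)
qed

text \<open>
  Choosing the antichain \<open>A\<close> maximal makes the part of each \<open>slot s\<close> incomparable to \<open>s\<close>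
  scattered, while the parts below and above \<open>s\<close> are scattered because \<open>S\<close> is maximal.
\<close>

lemma dense_scattered_slots:
  assumes T: "ordconvex lt T" "T \<subseteq> P" and ns: "nonscattered lt T"
  shows "\<exists>S\<subseteq>T. S \<noteq> {} \<and> (\<forall>x\<in>S. \<forall>y\<in>S. x = y \<or> x \<sqsubset> y \<or> y \<sqsubset> x) \<and>
    (\<forall>x\<in>S. \<forall>y\<in>S. x \<sqsubset> y \<longrightarrow> (\<exists>z\<in>S. x \<sqsubset> z \<and> z \<sqsubset> y)) \<and>
    (\<forall>x\<in>S. (\<exists>y\<in>S. y \<sqsubset> x) \<and> (\<exists>y\<in>S. x \<sqsubset> y)) \<and>
    (\<forall>s\<in>S. \<not> nonscattered lt {x \<in> T. \<forall>t\<in>S. (t \<sqsubset> s \<longrightarrow> t \<sqsubset> x) \<and> (s \<sqsubset> t \<longrightarrow> x \<sqsubset> t)})"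
proof -
  obtain A where A: "nonscattered lt (incomparable_part T A)"
    "\<And>s. s \<in> incomparable_part T A \<Longrightarrow> \<not> nonscattered lt (incomparable_part T (insert s A))"
    using maximal_antichain_nonscattered[OF T(2) ns] by blast
  define I where "I = incomparable_part T A"
  have between: "z \<in> I" if "x \<in> I" "y \<in> I" "x \<sqsubset> z" "z \<sqsubset> y" for x y z
    using that T(1) trans unfolding I_def incomparable_part_def ordconvex_def oi_def by blast
  \<comment> \<open>Related points have a non-scattered interval between them. A non-scattered piece
    of a slot on one side of its centre would then offer a further point for the maximal
    \<open>E\<close>-chain.\<close>
  define E where "E x y \<longleftrightarrow> x \<in> I \<and> y \<in> I \<and> x \<sqsubset> y \<and> nonscattered lt (oi lt x y)" for x y
  have tr: "E x z" if "E x y" "E y z" for x y z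
  proof -
    have "oi lt x y \<subseteq> oi lt x z" using that by (intro oi_mono) (auto simp: E_def)
    then show ?thesis using that trans nonscattered_mono[of lt "oi lt x y"] unfolding E_def by blast
  qed
  \<comment> \<open>The intermediate point can be taken from any prescribed non-scattered
    \<open>X\<close> in the interval, as a dense subset of \<open>X\<close> is non-scattered on both
    sides of an inner point.\<close>
  have dense: "\<exists>z. E x z \<and> E z y \<and> z \<in> X" if x: "x \<in> I" "y \<in> I" "X \<subseteq> oi lt x y" and X: "nonscattered lt X" for x y X
  proof -
    obtain S u v where S: "S \<subseteq> X" "u \<in> S" "v \<in> S" "u \<sqsubset> v"
      "\<forall>x\<in>S. \<forall>y\<in>S. x \<sqsubset> y \<longrightarrow> (\<exists>z\<in>S. x \<sqsubset> z \<and> z \<sqsubset> y)"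
      using X unfolding nonscattered_def by blast
    obtain z where z: "z \<in> S" "u \<sqsubset> z" "z \<sqsubset> v" using S by blast
    have ns: "nonscattered lt (oi lt u z)" "nonscattered lt (oi lt z v)"
      using nonscattered_mono[OF nonscattered_oi[OF S(5,2) z(1,2)] inf_le2]
        nonscattered_mono[OF nonscattered_oi[OF S(5) z(1) S(3) z(3)] inf_le2] .
    have xz: "x \<sqsubset> u" "v \<sqsubset> y" "x \<sqsubset> z" "z \<sqsubset> y"
      using S(1-3) x(3) z by (auto simp: oi_def)
    then have "oi lt u z \<subseteq> oi lt x z" "oi lt z v \<subseteq> oi lt z y" by (intro oi_mono; simp)+
    then have "nonscattered lt (oi lt x z)" "nonscattered lt (oi lt z y)"
      using nonscattered_mono[OF ns(1)] nonscattered_mono[OF ns(2)] by simp_all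
    then show ?thesis
      using xz x(1,2) between[OF x(1,2) xz(3,4)] z(1) S(1) unfolding E_def by blast
  qed
  obtain S' u v where S': "S' \<subseteq> I" "u \<in> S'" "v \<in> S'" "u \<sqsubset> v"
    "\<forall>x\<in>S'. \<forall>y\<in>S'. x \<sqsubset> y \<longrightarrow> (\<exists>z\<in>S'. x \<sqsubset> z \<and> z \<sqsubset> y)"
    using A(1) unfolding nonscattered_def I_def by blast
  have "nonscattered lt (oi lt u v)"
    using nonscattered_oi[OF S'(5,2-4)] inf_le2 by (rule nonscattered_mono)
  then have uv: "E u v" using S' by (auto simp: E_def)
  have dense': "\<exists>z. E x z \<and> E z y" if "E x y" for x y
    using dense[of x y "oi lt x y"] that by (auto simp: E_def)
  have E_lt: "x \<sqsubset> y" if "E x y" for x y using that by (simp add: E_def)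
  obtain M where M': "u \<in> M" "v \<in> M" "\<forall>x\<in>M. \<forall>y\<in>M. x = y \<or> E x y \<or> E y x"
    and Mx: "\<forall>z. (\<forall>t\<in>M. t = z \<or> E t z \<or> E z t) \<longrightarrow> z \<in> M"
    and Md': "\<forall>x\<in>M. \<forall>y\<in>M. x \<sqsubset> y \<longrightarrow> (\<exists>z\<in>M. x \<sqsubset> z \<and> z \<sqsubset> y)"
    by (rule maximal_dense_chain[of E, OF tr E_lt dense' uv])
  note M = M'(1,2) M'(3)[rule_format] and Md = Md'[rule_format]
  have MI: "M \<subseteq> I" using M(1,3) S' unfolding E_def by blast
  have ME: "E x y" if "x \<in> M" "y \<in> M" "x \<sqsubset> y" for x y
    using M(3)[OF that(1,2)] that(3) asym irrefl unfolding E_def by blast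
  \<comment> \<open>Possible end points of \<open>M\<close> are dropped, so that each slot is
    bounded by points of \<open>S\<close> on both sides and therefore lies in
    \<open>I\<close>.\<close>
  define S where "S = {s \<in> M. (\<exists>t\<in>M. t \<sqsubset> s) \<and> (\<exists>t\<in>M. s \<sqsubset> t)}"
  have SM: "S \<subseteq> M" by (auto simp: S_def)
  have mid: "z \<in> S" if "z \<in> M" "x \<in> M" "y \<in> M" "x \<sqsubset> z" "z \<sqsubset> y" for x y z
    using that by (auto simp: S_def)
  have S_below: "\<exists>t'\<in>S. t \<sqsubset> t' \<and> t' \<sqsubset> s" if "t \<in> M" "s \<in> M" "t \<sqsubset> s" for s t
    using Md[OF that] mid that by blast
  have scat: "\<not> nonscattered lt {x \<in> T. \<forall>t\<in>S. (t \<sqsubset> s \<longrightarrow> t \<sqsubset> x) \<and> (s \<sqsubset> t \<longrightarrow> x \<sqsubset> t)}" (is "\<not> nonscattered lt ?R")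
    if s: "s \<in> S" for s
  proof
    assume R: "nonscattered lt ?R"
    have sM: "s \<in> M" using s SM by blast
    obtain b1 where "b1 \<in> M" "b1 \<sqsubset> s" using s by (auto simp: S_def)
    then obtain b where b: "b \<in> S" "b \<sqsubset> s" using S_below sM by blast
    obtain c1 where "c1 \<in> M" "s \<sqsubset> c1" using s by (auto simp: S_def)
    then obtain c where c: "c \<in> S" "s \<sqsubset> c" using S_below[of s c1] sM by blast
    have RI: "?R \<subseteq> I"
    proof
      fix x assume "x \<in> ?R"
      then have "b \<sqsubset> x" "x \<sqsubset> c" using b c by auto
      then show "x \<in> I" using between b(1) c(1) SM MI by blast
    qed
    have "nonscattered lt ({x \<in> ?R. x \<sqsubset> s} \<union> ({x \<in> ?R. s \<sqsubset> x} \<union>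
        ({x \<in> ?R. x \<noteq> s \<and> \<not> x \<sqsubset> s \<and> \<not> s \<sqsubset> x} \<union> {x \<in> ?R. x = s})))"
      using R by (rule nonscattered_mono) blast
    then have cases: "nonscattered lt {x \<in> ?R. x \<sqsubset> s} \<or> nonscattered lt {x \<in> ?R. s \<sqsubset> x} \<or>
        nonscattered lt {x \<in> ?R. x \<noteq> s \<and> \<not> x \<sqsubset> s \<and> \<not> s \<sqsubset> x} \<or> nonscattered lt {x \<in> ?R. x = s}"
      by (elim disjE[OF nonscattered_Un]) (simp_all only: simp_thms)
    \<comment> \<open>Otherwise \<open>dense\<close> gives \<open>z\<close> in the slot below
      \<open>s\<close> with \<open>E z s\<close>. For \<open>t\<close> in \<open>M\<close> below
      \<open>s\<close>, a point \<open>t'\<close> of \<open>S\<close> between \<open>t\<close> and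
      \<open>s\<close> is below \<open>z\<close>, so \<open>E t t'\<close> implies
      \<open>E t z\<close>; thus \<open>z\<close> belongs to \<open>M\<close> and to
      \<open>S\<close>, and a slot point below \<open>s\<close> that is in \<open>S\<close> is below
      itself.\<close>
    have lower: "\<not> nonscattered lt {x \<in> ?R. x \<sqsubset> s}"
    proof
      assume n: "nonscattered lt {x \<in> ?R. x \<sqsubset> s}"
      have "{x \<in> ?R. x \<sqsubset> s} \<subseteq> oi lt b s" using b by (auto simp: oi_def)
      from dense[OF _ _ this n] obtain z where z: "E z s" "z \<in> ?R" "z \<sqsubset> s"
        using b(1) s SM MI by blast
      have "t = z \<or> E t z \<or> E z t" if t: "t \<in> M" for t
      proof -
        consider "t = s" | "t \<sqsubset> s" | "s \<sqsubset> t" using M(3)[OF t sM] unfolding E_def by blast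
        then show ?thesis
        proof cases
          case 1
          then show ?thesis using z by blast
        next
          case 2
          then obtain t' where t': "t' \<in> S" "t \<sqsubset> t'" "t' \<sqsubset> s" using S_below t sM by blast
          then have "t' \<sqsubset> z" using z by blast
          then have "oi lt t t' \<subseteq> oi lt t z" by (intro oi_mono) auto
          moreover have "E t t'" using ME t t' SM by blast
          ultimately have "nonscattered lt (oi lt t z)" using nonscattered_mono unfolding E_def by blast
          then have "E t z" using \<open>E t t'\<close> z(1) t' \<open>t' \<sqsubset> z\<close> trans unfolding E_def by blast
          then show ?thesis by blast
        next
          case 3
          then have "E z t" using z(1) ME[OF sM t] tr by blast
          then show ?thesis by blast
        qed
      qed
      then have "z \<in> M" using Mx by blast
      then have "z \<in> S" using mid[OF _ _ _ _ z(3)] b(1) sM SM z(2) b(2) by blast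
      then have "z \<sqsubset> z" using z(2,3) by blast
      then show False using irrefl by blast
    qed
    have upper: "\<not> nonscattered lt {x \<in> ?R. s \<sqsubset> x}"
    proof
      assume n: "nonscattered lt {x \<in> ?R. s \<sqsubset> x}"
      have "{x \<in> ?R. s \<sqsubset> x} \<subseteq> oi lt s c" using c by (auto simp: oi_def)
      from dense[OF _ _ this n] obtain z where z: "E s z" "z \<in> ?R" "s \<sqsubset> z"
        using c(1) s SM MI by blast
      have "t = z \<or> E t z \<or> E z t" if t: "t \<in> M" for t
      proof -
        consider "t = s" | "t \<sqsubset> s" | "s \<sqsubset> t" using M(3)[OF t sM] unfolding E_def by blast
        then show ?thesis
        proof cases
          case 1
          then show ?thesis using z by blast
        next
          case 3
          then obtain t' where t': "t' \<in> S" "s \<sqsubset> t'" "t' \<sqsubset> t" using S_below[of s t] t sM by blast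
          then have "z \<sqsubset> t'" using z by blast
          then have "oi lt t' t \<subseteq> oi lt z t" by (intro oi_mono) auto
          moreover have "E t' t" using ME t t' SM by blast
          ultimately have "nonscattered lt (oi lt z t)" using nonscattered_mono unfolding E_def by blast
          then have "E z t" using \<open>E t' t\<close> z(1) t' \<open>z \<sqsubset> t'\<close> trans unfolding E_def by blast
          then show ?thesis by blast
        next
          case 2
          then have "E t z" using z(1) ME[OF t sM] tr by blast
          then show ?thesis by blast
        qed
      qed
      then have "z \<in> M" using Mx by blast
      then have "z \<in> S" using mid[OF _ _ _ z(3)] c(1) sM SM z(2) c(2) by blast
      then have "z \<sqsubset> z" using z(2,3) by blast
      then show False using irrefl by blast
    qed
    have "{x \<in> ?R. x \<noteq> s \<and> \<not> x \<sqsubset> s \<and> \<not> s \<sqsubset> x} \<subseteq> incomparable_part T (insert s A)"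
      using RI by (auto simp: I_def incomparable_part_def)
    from nonscattered_mono[OF _ this]
    have side: "\<not> nonscattered lt {x \<in> ?R. x \<noteq> s \<and> \<not> x \<sqsubset> s \<and> \<not> s \<sqsubset> x}"
      using A(2)[of s] sM MI unfolding I_def by blast
    have "\<not> nonscattered lt {x \<in> ?R. x = s}"
      using irrefl unfolding nonscattered_def by blast
    then show False
      using cases lower upper side by blast
  qed
  have lin: "x = y \<or> x \<sqsubset> y \<or> y \<sqsubset> x" if "x \<in> S" "y \<in> S" for x y
    using M(3) SM that unfolding E_def by blast
  have Sd: "\<exists>z\<in>S. x \<sqsubset> z \<and> z \<sqsubset> y" if "x \<in> S" "y \<in> S" "x \<sqsubset> y" for x y
    using S_below SM that by blast
  have Se: "(\<exists>y\<in>S. y \<sqsubset> x) \<and> (\<exists>y\<in>S. x \<sqsubset> y)" if x: "x \<in> S" for x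
  proof -
    obtain t t' where "t \<in> M" "t \<sqsubset> x" "t' \<in> M" "x \<sqsubset> t'" using x by (auto simp: S_def)
    then show ?thesis using S_below[of t x] S_below[of x t'] x SM by blast
  qed
  have "S \<noteq> {}" using S_below[OF M(1,2) S'(4)] by blast
  moreover have "S \<subseteq> T" using SM MI by (auto simp: I_def incomparable_part_def)
  ultimately show ?thesis using lin Sd Se scat by (intro exI[of _ S]) blast
qed

text \<open>Regions of different slots are never adjacent: a slot strictly between them contributes
  a region. Within one slot the condition is that of its own family.\<close>

lemma slots_no_last_below:
  assumes lin: "\<And>x y. x \<in> S \<Longrightarrow> y \<in> S \<Longrightarrow> x = y \<or> x \<sqsubset> y \<or> y \<sqsubset> x"
    and dense: "\<And>x y. x \<in> S \<Longrightarrow> y \<in> S \<Longrightarrow> x \<sqsubset> y \<Longrightarrow> \<exists>z\<in>S. x \<sqsubset> z \<and> z \<sqsubset> y"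
    and cross: "\<And>s t Q R. s \<in> S \<Longrightarrow> t \<in> S \<Longrightarrow> s \<sqsubset> t \<Longrightarrow> Q \<in> N s \<Longrightarrow> R \<in> N t \<Longrightarrow> below lt Q R"
    and ne: "\<And>s. s \<in> S \<Longrightarrow> N s \<noteq> {}" "\<And>s Q. s \<in> S \<Longrightarrow> Q \<in> N s \<Longrightarrow> Q \<noteq> {}"
    and s: "s \<in> S" and Q: "Q \<in> N s" "no_last_below lt (N s) Q"
  shows "no_last_below lt (\<Union>s\<in>S. N s) Q"
  unfolding no_last_below_def
proof (intro ballI impI)
  fix R l assume R: "R \<in> (\<Union>s\<in>S. N s)" "below lt R Q" and l: "l \<in> R"
  then obtain t where t: "t \<in> S" "R \<in> N t" by blast
  consider "s = t" | "s \<sqsubset> t" | "t \<sqsubset> s" using lin[OF s t(1)] by blast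
  then show "\<exists>R'\<in>\<Union>s\<in>S. N s. below lt R' Q \<and> (\<exists>l'\<in>R'. l \<sqsubset> l')"
  proof cases
    case 1
    then have "\<exists>R'\<in>N s. below lt R' Q \<and> (\<exists>l'\<in>R'. l \<sqsubset> l')"
      using Q(2) R(2) l t(2) unfolding no_last_below_def by blast
    then show ?thesis using s by blast
  next
    case 2
    then have "below lt Q R" using cross s t Q(1) by blast
    then show ?thesis using below_antisym R(2) ne(2) s t Q(1) by blast
  next
    case 3
    then obtain z where z: "z \<in> S" "t \<sqsubset> z" "z \<sqsubset> s" using dense t(1) s by blast
    obtain R' where R': "R' \<in> N z" using ne(1)[OF z(1)] by blast
    then obtain r where r: "r \<in> R'" using ne(2)[OF z(1)] by blast
    have "below lt R' Q" using cross z s R' Q(1) by blast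
    moreover have "below lt R R'" using cross z t R' by blast
    then have "l \<sqsubset> r" using l r by (auto simp: below_def)
    ultimately show ?thesis using z(1) R' r by blast
  qed
qed

text \<open>In the dense case every slot is convex and scattered and gets its own family; the union
  of these is a family for \<open>T\<close>.\<close>

lemma region_family_exists:
  assumes T: "ordconvex lt T" "T \<subseteq> P" "T \<noteq> {}"
  shows "\<exists>\<Q>. \<Q> \<noteq> {} \<and> region_family lt T \<Q>"
proof (cases "nonscattered lt T")
  case False
  then show ?thesis using scattered_region_family T by blast
next
  case True
  interpret d: vac_order "lt\<inverse>\<inverse>" P by (rule vac_dual)
  obtain S where S: "S \<subseteq> T" "S \<noteq> {}" and lin': "\<forall>x\<in>S. \<forall>y\<in>S. x = y \<or> x \<sqsubset> y \<or> y \<sqsubset> x"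
    and dense': "\<forall>x\<in>S. \<forall>y\<in>S. x \<sqsubset> y \<longrightarrow> (\<exists>z\<in>S. x \<sqsubset> z \<and> z \<sqsubset> y)"
    and slots: "\<forall>s\<in>S. \<not> nonscattered lt {x \<in> T. \<forall>t\<in>S. (t \<sqsubset> s \<longrightarrow> t \<sqsubset> x) \<and> (s \<sqsubset> t \<longrightarrow> x \<sqsubset> t)}"
    using dense_scattered_slots[OF T(1,2) True] by (elim exE conjE)
  note lin = lin'[rule_format] and dense = dense'[rule_format]
  define slot where "slot s = {x \<in> T. \<forall>t\<in>S. (t \<sqsubset> s \<longrightarrow> t \<sqsubset> x) \<and> (s \<sqsubset> t \<longrightarrow> x \<sqsubset> t)}" for s
  have slotT: "slot s \<subseteq> T" for s by (auto simp: slot_def)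
  have "ordconvex lt (slot s)" for s
  proof -
    have "z \<in> slot s" if xyz: "x \<in> slot s" "y \<in> slot s" "x \<sqsubset> z" "z \<sqsubset> y" for x y z
    proof -
      have "z \<in> T" using ordconvexD[OF T(1)] xyz slotT by blast
      then show ?thesis using xyz trans unfolding slot_def by blast
    qed
    then show ?thesis unfolding ordconvex_def oi_def by blast
  qed
  moreover have "s \<in> slot s" if "s \<in> S" for s using that S by (auto simp: slot_def)
  moreover have "slot s \<subseteq> P" for s using slotT T(2) by blast
  ultimately have "\<exists>\<Q>. \<Q> \<noteq> {} \<and> region_family lt (slot s) \<Q>" if "s \<in> S" for s
    using scattered_region_family[of "slot s"] slots[folded slot_def] that by blast
  then obtain N where N0: "\<And>s. s \<in> S \<Longrightarrow> N s \<noteq> {} \<and> region_family lt (slot s) (N s)"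
    by metis
  then have N: "\<And>s. s \<in> S \<Longrightarrow> N s \<noteq> {}" "\<And>s. s \<in> S \<Longrightarrow> region_family lt (slot s) (N s)" by auto
  note D = region_familyD[OF N(2)]
  have cross: "below lt Q R" if st: "s \<in> S" "t \<in> S" "s \<sqsubset> t" and QR: "Q \<in> N s" "R \<in> N t" for s t Q R
    unfolding below_def
  proof (intro ballI)
    fix x y assume "x \<in> Q" "y \<in> R"
    then have "x \<in> slot s" "y \<in> slot t" using D(2) st QR by blast+
    moreover obtain z where "z \<in> S" "s \<sqsubset> z" "z \<sqsubset> t" using dense st by blast
    ultimately have "x \<sqsubset> z" "z \<sqsubset> y" unfolding slot_def by blast+
    then show "x \<sqsubset> y" using trans by blast
  qed
  let ?\<Q> = "\<Union>s\<in>S. N s"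
  have "region_family lt T ?\<Q>"
    unfolding region_family_def
  proof (intro conjI ballI impI)
    fix Q assume "Q \<in> ?\<Q>"
    then obtain s where s: "s \<in> S" "Q \<in> N s" by blast
    note DQ = D[OF s]
    show "Q \<noteq> {}" "star lt Q" "Q \<subseteq> T" using DQ(1-3) slotT by blast+
    show "Q = R \<or> below lt Q R \<or> below lt R Q" if R: "R \<in> ?\<Q>" for R
    proof -
      obtain t where "t \<in> S" "R \<in> N t" using R by blast
      then show ?thesis using lin[OF s(1)] s DQ(4) cross by blast
    qed
    show "no_last_below lt ?\<Q> Q" if "noasc lt\<inverse>\<inverse> Q"
      by (rule slots_no_last_below[where N = N]) (fact lin dense cross N(1) D(1) s DQ(6)[OF that])+
    show "no_last_below lt\<inverse>\<inverse> ?\<Q> Q" if "noasc lt Q"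
    proof (rule d.slots_no_last_below[where N = N])
      show "x = y \<or> lt\<inverse>\<inverse> x y \<or> lt\<inverse>\<inverse> y x" if "x \<in> S" "y \<in> S" for x y using lin that by auto
      show "\<exists>z\<in>S. lt\<inverse>\<inverse> x z \<and> lt\<inverse>\<inverse> z y" if "x \<in> S" "y \<in> S" "lt\<inverse>\<inverse> x y" for x y
        using dense[of y x] that by auto
      show "below lt\<inverse>\<inverse> Q R" if "s \<in> S" "t \<in> S" "lt\<inverse>\<inverse> s t" "Q \<in> N s" "R \<in> N t" for s t Q R
        using cross[of t s R Q] that by simp
    qed (fact N(1) D(1) s DQ(7)[OF that])+
    fix x assume x: "x \<in> T" "compat lt ?\<Q> Q x" "noasc lt Q \<or> (\<exists>q\<in>Q. x \<sqsubset> q)"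
      "noasc lt\<inverse>\<inverse> Q \<or> (\<exists>q\<in>Q. q \<sqsubset> x)"
    \<comment> \<open>A region in a slot between \<open>t\<close> and \<open>s\<close> separates
      \<open>x\<close> from \<open>t\<close>. So a point that \<open>Q\<close> has to absorb is in
      the slot of \<open>Q\<close>, where the family of that slot takes care of it.\<close>
    have "t \<sqsubset> x" if t: "t \<in> S" "t \<sqsubset> s" for t
    proof -
      obtain z where z: "z \<in> S" "t \<sqsubset> z" "z \<sqsubset> s" using dense t s(1) by blast
      obtain R where R: "R \<in> N z" using N(1)[OF z(1)] by blast
      then obtain r where r: "r \<in> R" "r \<in> slot z" using D(1,2)[OF z(1) R] by blast
      have "below lt R Q" using cross z s R by blast
      then have "r \<sqsubset> x" using x(2) z(1) R r(1) unfolding compat_def below_def by blast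
      moreover have "t \<sqsubset> r" using r(2) t(1) z(2) by (simp add: slot_def)
      ultimately show ?thesis using trans by blast
    qed
    moreover have "x \<sqsubset> t" if t: "t \<in> S" "s \<sqsubset> t" for t
    proof -
      obtain z where z: "z \<in> S" "s \<sqsubset> z" "z \<sqsubset> t" using dense t s(1) by blast
      obtain R where R: "R \<in> N z" using N(1)[OF z(1)] by blast
      then obtain r where r: "r \<in> R" "r \<in> slot z" using D(1,2)[OF z(1) R] by blast
      have "below lt Q R" using cross z s R by blast
      then have "x \<sqsubset> r" using x(2) z(1) R r(1) unfolding compat_def below_def by blast
      moreover have "r \<sqsubset> t" using r(2) t(1) z(3) by (simp add: slot_def)
      ultimately show ?thesis using trans by blast
    qed
    ultimately have "x \<in> slot s" using x(1) by (simp add: slot_def)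
    moreover have "compat lt (N s) Q x" using x(2) s(1) by (blast intro: compat_subset)
    ultimately show "x \<in> Q" using DQ(5) x(3,4) by blast
  qed
  moreover have "?\<Q> \<noteq> {}" using S(2) N(1) by blast
  ultimately show ?thesis by blast
qed

section \<open>Inserting a family into a gap\<close>

lemma below_gap:
  "M \<subseteq> gap lt P \<Q> p \<Longrightarrow> R \<in> \<Q> \<Longrightarrow> below lt R {p} \<Longrightarrow> below lt R M"
  "M \<subseteq> gap lt P \<Q> p \<Longrightarrow> R \<in> \<Q> \<Longrightarrow> below lt {p} R \<Longrightarrow> below lt M R"
  unfolding gap_def below_def by blast+

text \<open>Only an old and a new region can conflict, and absorption rules this out. A last element
  of new regions below an old \<open>Q\<close> would fit into \<open>Q\<close> and so belong to it;
  an old \<open>R\<close> that ends right below a new \<open>Q\<close> would have absorbed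
  \<open>p\<close>.\<close>

lemma region_family_Un_no_last_below:
  assumes fam: "region_family lt P \<Q>" and p: "p \<in> P" "\<And>R. R \<in> \<Q> \<Longrightarrow> below lt R {p} \<or> below lt {p} R"
    and N: "region_family lt (gap lt P \<Q> p) \<N>" and Q: "Q \<in> \<Q> \<union> \<N>" "noasc lt\<inverse>\<inverse> Q"
  shows "no_last_below lt (\<Q> \<union> \<N>) Q"
  unfolding no_last_below_def
proof (intro ballI impI)
  note D = region_familyD[OF fam] and E = region_familyD[OF N]
  have lowN: "below lt R M" if "R \<in> \<Q>" "M \<in> \<N>" "below lt R {p}" for R M
    using below_gap(1)[OF E(2)] that by blast
  have upN: "below lt M R" if "R \<in> \<Q>" "M \<in> \<N>" "below lt {p} R" for R M
    using below_gap(2)[OF E(2)] that by blast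
  fix R l assume R: "R \<in> \<Q> \<union> \<N>" "below lt R Q" and l: "l \<in> R"
  let ?thesis = "\<exists>R'\<in>\<Q> \<union> \<N>. below lt R' Q \<and> (\<exists>l'\<in>R'. l \<sqsubset> l')"
  show ?thesis
  proof (cases "Q \<in> \<Q>")
    case QQ: True
    show ?thesis
    proof (cases "R \<in> \<Q>")
      case True
      then have "\<exists>R'\<in>\<Q>. below lt R' Q \<and> (\<exists>l'\<in>R'. l \<sqsubset> l')"
        using D(6)[OF QQ Q(2)] R(2) l unfolding no_last_below_def by blast
      then show ?thesis by blast
    next
      case False
      then have RN: "R \<in> \<N>" using R by blast
      have lgap: "l \<in> gap lt P \<Q> p" using E(2)[OF RN] l by blast
      have pQ: "below lt {p} Q"
      proof (rule ccontr)
        assume "\<not> below lt {p} Q"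
        then have "below lt Q R" using p(2)[OF QQ] lowN[OF QQ RN] by blast
        then show False using R(2) below_antisym D(1)[OF QQ] E(1)[OF RN] by blast
      qed
      show ?thesis
      proof (rule ccontr)
        assume no: "\<not> ?thesis"
        have "compat lt \<Q> Q l"
          unfolding compat_def
        proof (intro ballI conjI impI)
          fix A assume A: "A \<in> \<Q>"
          show "below lt A {l}" if AQ: "below lt A Q"
          proof -
            have "\<not> below lt {p} A"
            proof
              assume "below lt {p} A"
              then have "below lt {l} A" using lgap A unfolding gap_def by blast
              then show False using no A AQ D(1)[OF A] unfolding below_def by blast
            qed
            then have "below lt A {p}" using p(2)[OF A] by blast
            then show ?thesis using lgap A unfolding gap_def by blast
          qed
          show "below lt {l} A" if QA: "below lt Q A"
          proof -
            have "below lt {p} A" using below_trans[OF pQ QA] D(1)[OF QQ] by blast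
            then show ?thesis using lgap A unfolding gap_def by blast
          qed
        qed
        moreover have "\<exists>q\<in>Q. l \<sqsubset> q" using R(2) l D(1)[OF QQ] unfolding below_def by blast
        moreover have "l \<in> P" using lgap by (simp add: gap_def)
        ultimately have "l \<in> Q" using D(5)[OF QQ] Q(2) by blast
        then show False using R(2) l irrefl unfolding below_def by blast
      qed
    qed
  next
    case False
    then have QN: "Q \<in> \<N>" using Q by blast
    show ?thesis
    proof (cases "R \<in> \<N>")
      case True
      then have "\<exists>R'\<in>\<N>. below lt R' Q \<and> (\<exists>l'\<in>R'. l \<sqsubset> l')"
        using E(6)[OF QN Q(2)] R(2) l unfolding no_last_below_def by blast
      then show ?thesis by blast
    next
      case False
      then have RQ: "R \<in> \<Q>" using R by blast
      have Rp: "below lt R {p}"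
      proof (rule ccontr)
        assume "\<not> below lt R {p}"
        then have "below lt Q R" using p(2)[OF RQ] upN[OF RQ QN] by blast
        then show False using R(2) below_antisym D(1)[OF RQ] E(1)[OF QN] by blast
      qed
      show ?thesis
      proof (rule ccontr)
        assume no: "\<not> ?thesis"
        have "\<not> l \<sqsubset> l'" if "A \<in> \<Q>" "below lt A {p}" "l' \<in> A" for A l'
          using no that lowN[OF that(1) QN that(2)] by blast
        note top = this
        \<comment> \<open>By \<open>star\<close>, an ascending sequence in \<open>R\<close> would
          pass above \<open>l\<close>, which is topmost among the old regions below
          \<open>p\<close>.\<close>
        have "noasc lt R"
          unfolding noasc_def
        proof (intro notI, elim exE)
          fix z assume z: "asc lt R z"
          then obtain i where "l \<sqsubset> z i" using D(3)[OF RQ] l unfolding star_def by blast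
          then show False using top[OF RQ Rp] z unfolding asc_def by blast
        qed
        moreover have "compat lt \<Q> R p"
          unfolding compat_def
        proof (intro ballI conjI impI)
          fix A assume A: "A \<in> \<Q>"
          show "below lt A {p}" if AR: "below lt A R"
            using below_trans[OF AR Rp] D(1)[OF RQ] by blast
          show "below lt {p} A" if RA: "below lt R A"
          proof (rule ccontr)
            assume "\<not> below lt {p} A"
            then have "below lt A {p}" using p(2)[OF A] by blast
            then show False using top[OF A] RA l D(1)[OF A] unfolding below_def by blast
          qed
        qed
        moreover have "\<exists>q\<in>R. q \<sqsubset> p" using Rp l unfolding below_def by blast
        ultimately have "p \<in> R" using D(5)[OF RQ p(1)] by blast
        then show False using Rp irrefl unfolding below_def by blast
      qed
    qed
  qed
qed

lemma region_family_Un: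
  assumes fam: "region_family lt P \<Q>" and p: "p \<in> P" "\<And>R. R \<in> \<Q> \<Longrightarrow> below lt R {p} \<or> below lt {p} R"
    and N: "region_family lt (gap lt P \<Q> p) \<N>"
  shows "region_family lt P (\<Q> \<union> \<N>)"
proof -
  interpret d: vac_order "lt\<inverse>\<inverse>" P by (rule vac_dual)
  note D = region_familyD[OF fam] and E = region_familyD[OF N]
  have gP: "gap lt P \<Q> p \<subseteq> P" by (auto simp: gap_def)
  have lin: "below lt R M \<or> below lt M R" if "R \<in> \<Q>" "M \<in> \<N>" for R M
    using below_gap[OF E(2)[OF that(2)] that(1)] p(2)[OF that(1)] by blast
  show ?thesis
    unfolding region_family_def
  proof (intro conjI ballI impI)
    fix Q assume Q: "Q \<in> \<Q> \<union> \<N>"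
    show "Q \<noteq> {}" "star lt Q" "Q \<subseteq> P" using Q D(1-3)[of Q] E(1-3)[of Q] gP by auto
    show "Q = R \<or> below lt Q R \<or> below lt R Q" if R: "R \<in> \<Q> \<union> \<N>" for R
      using Q R D(4)[of Q R] E(4)[of Q R] lin[of Q R] lin[of R Q] by auto
    show "no_last_below lt (\<Q> \<union> \<N>) Q" if "noasc lt\<inverse>\<inverse> Q"
      using region_family_Un_no_last_below[OF fam p N Q that] .
    show "no_last_below lt\<inverse>\<inverse> (\<Q> \<union> \<N>) Q" if "noasc lt Q"
    proof (rule d.region_family_Un_no_last_below[of \<Q> p \<N> Q])
      show "below lt\<inverse>\<inverse> R {p} \<or> below lt\<inverse>\<inverse> {p} R" if "R \<in> \<Q>" for R
        using p(2)[OF that] by auto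
    qed (use fam N p(1) Q that in simp_all)
    fix x assume x: "x \<in> P" "compat lt (\<Q> \<union> \<N>) Q x" "noasc lt Q \<or> (\<exists>q\<in>Q. x \<sqsubset> q)"
      "noasc lt\<inverse>\<inverse> Q \<or> (\<exists>q\<in>Q. q \<sqsubset> x)"
    have cQ: "compat lt \<Q> Q x" "compat lt \<N> Q x" using x(2) by (auto intro: compat_subset)
    show "x \<in> Q"
    proof (cases "Q \<in> \<Q>")
      case True
      then show ?thesis using D(5) x cQ by blast
    next
      case False
      then have QN: "Q \<in> \<N>" using Q by blast
      \<comment> \<open>Each old region lies on the same side of the new \<open>Q\<close> as of
        \<open>p\<close>, so compatibility with the old regions puts \<open>x\<close> into the
        gap.\<close>
      have "x \<in> gap lt P \<Q> p"
        unfolding gap_def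
      proof (intro CollectI conjI ballI impI)
        show "x \<in> P" by (rule x(1))
        fix R assume R: "R \<in> \<Q>"
        show "below lt R {x}" if "below lt R {p}"
        proof -
          have "below lt R Q" using below_gap(1)[OF E(2)[OF QN] R that] .
          then show ?thesis using cQ(1) R unfolding compat_def by blast
        qed
        show "below lt {x} R" if "below lt {p} R"
        proof -
          have "below lt Q R" using below_gap(2)[OF E(2)[OF QN] R that] .
          then show ?thesis using cQ(1) R unfolding compat_def by blast
        qed
      qed
      then show ?thesis using E(5)[OF QN] x cQ by blast
    qed
  qed
qed

section \<open>Maximal families\<close>

lemma Union_chain_no_last_below:
  assumes ch: "\<And>X Y. X \<in> \<D> \<Longrightarrow> Y \<in> \<D> \<Longrightarrow> X \<subseteq> Y \<or> Y \<subseteq> X"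
    and fam: "\<And>\<Q>. \<Q> \<in> \<D> \<Longrightarrow> Q \<in> \<Q> \<Longrightarrow> no_last_below lt \<Q> Q" and Q: "Q \<in> \<Union>\<D>"
  shows "no_last_below lt (\<Union>\<D>) Q"
  unfolding no_last_below_def
proof (intro ballI impI)
  fix R l assume R: "R \<in> \<Union>\<D>" "below lt R Q" "l \<in> R"
  obtain X Y where "X \<in> \<D>" "Y \<in> \<D>" "Q \<in> X" "R \<in> Y" using Q R(1) by blast
  then obtain Z where Z: "Z \<in> \<D>" "Q \<in> Z" "R \<in> Z" using ch by blast
  then have "\<exists>R'\<in>Z. below lt R' Q \<and> (\<exists>l'\<in>R'. l \<sqsubset> l')"
    using fam[of Z] R unfolding no_last_below_def by blast
  then show "\<exists>R'\<in>\<Union>\<D>. below lt R' Q \<and> (\<exists>l'\<in>R'. l \<sqsubset> l')" using Z(1) by blast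
qed

lemma region_family_Union_chain:
  assumes ch: "\<And>X Y. X \<in> \<D> \<Longrightarrow> Y \<in> \<D> \<Longrightarrow> X \<subseteq> Y \<or> Y \<subseteq> X"
    and fam: "\<And>\<Q>. \<Q> \<in> \<D> \<Longrightarrow> region_family lt P \<Q>"
  shows "region_family lt P (\<Union>\<D>)"
  unfolding region_family_def
proof (intro conjI ballI impI)
  interpret d: vac_order "lt\<inverse>\<inverse>" P by (rule vac_dual)
  fix Q assume Q: "Q \<in> \<Union>\<D>"
  then obtain X where X: "X \<in> \<D>" "Q \<in> X" by blast
  note D = region_familyD[OF fam]
  show "Q \<noteq> {}" "Q \<subseteq> P" "star lt Q" using D(1-3)[OF X] by auto
  show "Q = R \<or> below lt Q R \<or> below lt R Q" if R: "R \<in> \<Union>\<D>" for R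
  proof -
    obtain Y where "Y \<in> \<D>" "R \<in> Y" using R by blast
    then obtain Z where "Z \<in> \<D>" "Q \<in> Z" "R \<in> Z" using ch X by blast
    then show ?thesis using D(4) by blast
  qed
  show "no_last_below lt (\<Union>\<D>) Q" if "noasc lt\<inverse>\<inverse> Q"
    using Union_chain_no_last_below[of \<D> Q] ch D(6) that Q by blast
  show "no_last_below lt\<inverse>\<inverse> (\<Union>\<D>) Q" if "noasc lt Q"
    using d.Union_chain_no_last_below[of \<D> Q] ch D(7) that Q by blast
  show "x \<in> Q" if x: "x \<in> P" "compat lt (\<Union>\<D>) Q x" "noasc lt Q \<or> (\<exists>q\<in>Q. x \<sqsubset> q)"
      "noasc lt\<inverse>\<inverse> Q \<or> (\<exists>q\<in>Q. q \<sqsubset> x)" for x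
  proof -
    have "compat lt X Q x" using compat_subset[OF x(2)] X(1) by blast
    then show ?thesis using D(5)[OF X] x by blast
  qed
qed

text \<open>A point above or below each region would leave a nonempty convex gap around it, which
  has a family of its own that enlarges the maximal one.\<close>

lemma maximal_region_family:
  "\<exists>\<Q>. region_family lt P \<Q> \<and> (\<forall>p\<in>P. \<exists>R\<in>\<Q>. \<not> below lt R {p} \<and> \<not> below lt {p} R)"
proof -
  have "\<exists>M\<in>{\<Q>. region_family lt P \<Q>}. \<forall>X\<in>{\<Q>. region_family lt P \<Q>}. M \<subseteq> X \<longrightarrow> X = M"
  proof (rule subset_Zorn')
    fix \<D> assume D: "subset.chain {\<Q>. region_family lt P \<Q>} \<D>"
    then show "\<Union>\<D> \<in> {\<Q>. region_family lt P \<Q>}"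
      using region_family_Union_chain[of \<D>] by (auto simp: subset_chain_def)
  qed
  then obtain M where M: "region_family lt P M" and mx: "\<And>X. region_family lt P X \<Longrightarrow> M \<subseteq> X \<Longrightarrow> X = M"
    by blast
  have "\<exists>R\<in>M. \<not> below lt R {p} \<and> \<not> below lt {p} R" if p: "p \<in> P" for p
  proof (rule ccontr)
    assume "\<not> ?thesis"
    then have c: "\<And>R. R \<in> M \<Longrightarrow> below lt R {p} \<or> below lt {p} R" by blast
    let ?T = "gap lt P M p"
    have "z \<in> ?T" if xyz: "x \<in> ?T" "y \<in> ?T" "x \<sqsubset> z" "z \<sqsubset> y" for x y z
      unfolding gap_def
    proof (intro CollectI conjI ballI impI)
      show "z \<in> P" using field xyz(3) by blast
      fix R assume R: "R \<in> M"
      show "below lt R {z}" if "below lt R {p}"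
      proof -
        have "below lt R {x}" using xyz(1) R that unfolding gap_def by blast
        then show ?thesis using xyz(3) trans unfolding below_def by blast
      qed
      show "below lt {z} R" if "below lt {p} R"
      proof -
        have "below lt {y} R" using xyz(2) R that unfolding gap_def by blast
        then show ?thesis using xyz(4) trans unfolding below_def by blast
      qed
    qed
    then have "ordconvex lt ?T" unfolding ordconvex_def oi_def by blast
    moreover have "?T \<subseteq> P" "p \<in> ?T" using p by (auto simp: gap_def)
    ultimately obtain \<N> where N: "\<N> \<noteq> {}" "region_family lt ?T \<N>"
      using region_family_exists[of ?T] by blast
    then have "M \<union> \<N> = M" using mx[OF region_family_Un[OF M p c N(2)]] by blast
    \<comment> \<open>A region of both families would lie inside the gap and so on one side of
      itself.\<close>
    then obtain Q where "Q \<in> M" "Q \<in> \<N>" using N(1) by blast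
    then have Q: "Q \<noteq> {}" "Q \<subseteq> ?T" "Q \<in> M" using region_familyD(1,2)[OF N(2)] by blast+
    then have "below lt Q Q" using c[of Q] unfolding gap_def below_def by blast
    then show False using below_irrefl Q(1) by blast
  qed
  then show ?thesis using M by blast
qed

end

section \<open>Points outside the regions\<close>

lemma spine_map_conversep [simp]: "spine_map lt\<inverse>\<inverse> X f = spine_map lt X f"
  unfolding spine_map_def by auto

lemma spine_mapD:
  assumes "spine_map lt X f" "x \<in> X"
  shows "f x \<in> X" "f (f x) = f x" "y \<in> X \<Longrightarrow> f x = f y \<Longrightarrow> \<not> lt x y"
    "y \<in> X \<Longrightarrow> f x = f y \<or> lt (f x) (f y) \<or> lt (f y) (f x)"
  using assms unfolding spine_map_def by blast+

text \<open>
  The classes \<open>f\<inverse>(c)\<close> to which \<open>p\<close> can be added without destroying the antichain.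
\<close>

definition free_colours :: "('a \<Rightarrow> 'a \<Rightarrow> bool) \<Rightarrow> 'a set \<Rightarrow> ('a \<Rightarrow> 'a) \<Rightarrow> 'a \<Rightarrow> 'a set" where
  "free_colours lt X f p = {c \<in> f ` X. \<forall>x\<in>X. f x = c \<longrightarrow> \<not> lt x p \<and> \<not> lt p x}"

lemma free_colours_conversep [simp]: "free_colours lt\<inverse>\<inverse> X f p = free_colours lt X f p"
  unfolding free_colours_def by auto

context vac_order
begin

text \<open>The colours along one ascending sequence \<open>z\<close> are pairwise distinct, and all
  but finitely many of them turn out to be free.\<close>

lemma infinite_free_colours_asc:
  assumes Q: "star lt Q" "Q \<subseteq> P" and f: "spine_map lt Q f" and z: "\<not> noasc lt Q"
    and p: "\<And>q. q \<in> Q \<Longrightarrow> \<not> p \<sqsubset> q" and q0: "q0 \<in> Q" "\<not> q0 \<sqsubset> p"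
  shows "infinite (free_colours lt Q f p)"
proof
  let ?H = "free_colours lt Q f p"
  assume fin: "finite ?H"
  obtain z where z: "asc lt Q z" using z by (auto simp: noasc_def)
  have zQ: "z i \<in> Q" for i using z by (simp add: asc_def)
  have neq: "f (z i) \<noteq> f (z j)" if "i < j" for i j
    using spine_mapD(3)[OF f zQ zQ] asc_less[OF z that] by blast
  have inj: "inj (\<lambda>i. f (z i))"
    by (rule injI) (metis neq linorder_neqE_nat)
  define X where "X = {x \<in> Q. x \<sqsubset> p \<and> (\<exists>i. f x = f (z i))}"
  \<comment> \<open>As \<open>p\<close> is below nothing in \<open>Q\<close>, a colour can be
    blocked only by a point of \<open>Q\<close> below \<open>p\<close>.\<close>
  have "range (\<lambda>i. f (z i)) \<subseteq> ?H \<union> f ` X"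
  proof
    fix c assume "c \<in> range (\<lambda>i. f (z i))"
    then obtain i where i: "c = f (z i)" by blast
    then have "c \<in> f ` Q" using zQ by blast
    show "c \<in> ?H \<union> f ` X"
    proof (cases "c \<in> ?H")
      case False
      then obtain x where "x \<in> Q" "f x = c" "x \<sqsubset> p"
        using \<open>c \<in> f ` Q\<close> p unfolding free_colours_def by blast
      then have "x \<in> X" using i by (auto simp: X_def)
      then show ?thesis using \<open>f x = c\<close> by blast
    qed simp
  qed
  then have "infinite (f ` X)"
    using fin range_inj_infinite[OF inj] finite_subset by blast
  then have "infinite X" by blast
  then obtain w where w: "asc lt X w \<or> asc lt\<inverse>\<inverse> X w"
    using infinite_asc_or_desc[of X] Q(2) by (auto simp: X_def)
  have wX: "w i \<in> X" for i using w by (auto simp: asc_def)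
  have XQ: "X \<subseteq> Q" by (auto simp: X_def)
  show False
  proof (cases "asc lt X w")
    case True
    then have "asc lt Q w" using XQ by (rule asc_subset)
    then obtain i where "q0 \<sqsubset> w i" using Q(1) q0(1) unfolding star_def by blast
    moreover have "w i \<sqsubset> p" using wX by (simp add: X_def)
    ultimately show False using q0(2) trans by blast
  next
    case False
    then have "asc lt\<inverse>\<inverse> Q w" using w XQ asc_subset by blast
    \<comment> \<open>A descending sequence of blocking points drops below \<open>z 0\<close>, hence
      below the term of \<open>z\<close> with the same colour, although the points of one colour
      form an antichain.\<close>
    then obtain i where i: "w i \<sqsubset> z 0" using Q(1) zQ unfolding star_def by blast
    obtain k where k: "f (w i) = f (z k)" using wX[of i] by (auto simp: X_def)
    have "w i \<sqsubset> z k" using i asc_less[OF z, of 0 k] trans by (cases "k = 0") auto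
    then show False using spine_mapD(3)[OF f _ zQ k] wX[of i] XQ by blast
  qed
qed

lemma infinite_free_colours_desc:
  assumes "star lt Q" "Q \<subseteq> P" "spine_map lt Q f" "\<not> noasc lt\<inverse>\<inverse> Q"
    and "\<And>q. q \<in> Q \<Longrightarrow> \<not> q \<sqsubset> p" "q0 \<in> Q" "\<not> p \<sqsubset> q0"
  shows "infinite (free_colours lt Q f p)"
proof -
  interpret d: vac_order "lt\<inverse>\<inverse>" P by (rule vac_dual)
  show ?thesis using d.infinite_free_colours_asc[of Q f p q0] assms by simp
qed

lemma region_disjoint:
  assumes "region_family lt P \<Q>" "Q \<in> \<Q>" "R \<in> \<Q>" "x \<in> Q" "x \<in> R"
  shows "Q = R"
  using region_familyD(4)[OF assms(1-3)] assms(4,5) irrefl unfolding below_def by blast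

text \<open>Since the maps preserve the disjoint, linearly ordered regions, gluing them keeps the
  fibres inside regions and makes the union of the chains a chain.\<close>

lemma family_spine_map:
  assumes fam: "region_family lt P \<Q>"
  shows "\<exists>f. spine_map lt (\<Union>\<Q>) f \<and> (\<forall>Q\<in>\<Q>. spine_map lt Q f)"
proof -
  note D = region_familyD[OF fam]
  have "\<forall>Q\<in>\<Q>. \<exists>f. spine_map lt Q f" using star_spine_map D(1-3) by blast
  then obtain g where g: "\<And>Q. Q \<in> \<Q> \<Longrightarrow> spine_map lt Q (g Q)" by metis
  define f where "f x = g (THE Q. Q \<in> \<Q> \<and> x \<in> Q) x" for x
  have fg: "f x = g Q x" if "Q \<in> \<Q>" "x \<in> Q" for x Q
  proof -
    have "(THE Q. Q \<in> \<Q> \<and> x \<in> Q) = Q"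
      using that region_disjoint[OF fam] by (intro the_equality) blast+
    then show ?thesis by (simp add: f_def)
  qed
  have fQ: "spine_map lt Q f" if Q: "Q \<in> \<Q>" for Q
    using g[OF Q] fg[OF Q] unfolding spine_map_def by auto
  have "spine_map lt (\<Union>\<Q>) f"
    unfolding spine_map_def
  proof (intro conjI ballI impI)
    fix x assume "x \<in> \<Union>\<Q>"
    then obtain Q where Q: "Q \<in> \<Q>" "x \<in> Q" by blast
    note fx = spine_mapD[OF fQ[OF Q(1)] Q(2)]
    show "f x \<in> \<Union>\<Q>" "f (f x) = f x" using fx(1,2) Q(1) by blast+
    fix y assume "y \<in> \<Union>\<Q>"
    then obtain R where R: "R \<in> \<Q>" "y \<in> R" by blast
    note fy = spine_mapD[OF fQ[OF R(1)] R(2)]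
    show "\<not> x \<sqsubset> y" if "f x = f y"
    proof -
      have "Q = R" using region_disjoint[OF fam Q(1) R(1) fx(1)] fy(1) that by simp
      then show ?thesis using fx(3) R(2) that by blast
    qed
    show "f x = f y \<or> f x \<sqsubset> f y \<or> f y \<sqsubset> f x"
      using D(4)[OF Q(1) R(1)] fx(1,4) fy(1) R(2) unfolding below_def by blast
  qed
  then show ?thesis using fQ by blast
qed

text \<open>With finitely many free colours, only finitely many regions are neither above nor below
  \<open>p\<close>, and their ends facing \<open>p\<close> carry no infinite sequence. Two
  consecutive ones contradict the condition on adjacent ends; a single one would have absorbed
  \<open>p\<close>.\<close>

lemma infinite_free_colours:
  assumes fam: "region_family lt P \<Q>" and p: "p \<in> P" "p \<notin> \<Union>\<Q>"
    and comp: "\<exists>R\<in>\<Q>. \<not> below lt R {p} \<and> \<not> below lt {p} R"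
    and fU: "spine_map lt (\<Union>\<Q>) f" and fQ: "\<And>Q. Q \<in> \<Q> \<Longrightarrow> spine_map lt Q f"
  shows "infinite (free_colours lt (\<Union>\<Q>) f p)"
proof
  let ?H = "free_colours lt (\<Union>\<Q>) f p"
  assume fin: "finite ?H"
  note D = region_familyD[OF fam]
  define \<I> where "\<I> = {Q \<in> \<Q>. \<not> below lt Q {p} \<and> \<not> below lt {p} Q}"
  have I: "Q \<in> \<Q>" "\<not> below lt Q {p}" "\<not> below lt {p} Q" if "Q \<in> \<I>" for Q
    using that by (auto simp: \<I>_def)
  \<comment> \<open>A fibre lies in one region, so being free within \<open>Q\<close> means being
    free altogether.\<close>
  have sub: "free_colours lt Q f p \<subseteq> ?H" if Q: "Q \<in> \<Q>" for Q
  proof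
    fix c assume c: "c \<in> free_colours lt Q f p"
    then have "c \<in> Q" using spine_mapD(1)[OF fQ[OF Q]] by (auto simp: free_colours_def)
    have "x \<in> Q" if x: "x \<in> \<Union>\<Q>" "f x = c" for x
    proof -
      obtain R where R: "R \<in> \<Q>" "x \<in> R" using x(1) by blast
      then have "c \<in> R" using spine_mapD(1)[OF fQ] x(2) by blast
      then show ?thesis using region_disjoint[OF fam Q R(1) \<open>c \<in> Q\<close>] R(2) by blast
    qed
    then show "c \<in> ?H" using c Q unfolding free_colours_def by blast
  qed
  have a: "noasc lt Q" if Q: "Q \<in> \<I>" "\<And>q. q \<in> Q \<Longrightarrow> \<not> p \<sqsubset> q" for Q
  proof (rule ccontr)
    assume n: "\<not> noasc lt Q"
    note QQ = I(1)[OF Q(1)]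
    obtain q0 where "q0 \<in> Q" "\<not> q0 \<sqsubset> p" using I(2)[OF Q(1)] by (auto simp: below_def)
    then have "infinite (free_colours lt Q f p)"
      using infinite_free_colours_asc[OF D(3,2)[OF QQ] fQ[OF QQ] n] Q(2) by blast
    then show False using sub[OF QQ] fin finite_subset by blast
  qed
  have b: "noasc lt\<inverse>\<inverse> Q" if Q: "Q \<in> \<I>" "\<And>q. q \<in> Q \<Longrightarrow> \<not> q \<sqsubset> p" for Q
  proof (rule ccontr)
    assume n: "\<not> noasc lt\<inverse>\<inverse> Q"
    note QQ = I(1)[OF Q(1)]
    obtain q0 where "q0 \<in> Q" "\<not> p \<sqsubset> q0" using I(3)[OF Q(1)] by (auto simp: below_def)
    then have "infinite (free_colours lt Q f p)"
      using infinite_free_colours_desc[OF D(3,2)[OF QQ] fQ[OF QQ] n] Q(2) by blast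
    then show False using sub[OF QQ] fin finite_subset by blast
  qed
  have notabove: "\<not> q \<sqsubset> p" if "R \<in> \<I>" "Q \<in> \<I>" "below lt R Q" "q \<in> Q" for R Q q
    using I(2)[OF that(1)] that(3,4) trans unfolding below_def by blast
  have notbelow: "\<not> p \<sqsubset> q" if "R \<in> \<I>" "Q \<in> \<I>" "below lt Q R" "q \<in> Q" for R Q q
    using I(3)[OF that(1)] that(3,4) trans unfolding below_def by blast
  have lin: "Q = R \<or> below lt Q R \<or> below lt R Q" if "Q \<in> \<I>" "R \<in> \<I>" for Q R
    using D(4)[OF I(1) I(1)] that by blast
  have "finite \<I>"
  proof -
    \<comment> \<open>A region between two members of \<open>\<I>\<close> is entirely incomparable
      to \<open>p\<close>, so all its colours are free. Apart from these, \<open>\<I>\<close> has at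
      most a first and a last member.\<close>
    define M where "M = {Q \<in> \<I>. (\<exists>R\<in>\<I>. below lt R Q) \<and> (\<exists>R\<in>\<I>. below lt Q R)}"
    have MH: "\<exists>c. c \<in> ?H \<and> c \<in> Q" if "Q \<in> M" for Q
    proof -
      have Q: "Q \<in> \<I>" "Q \<in> \<Q>" using that I(1) by (auto simp: M_def)
      obtain x where x: "x \<in> Q" using D(1)[OF Q(2)] by blast
      have "\<not> q \<sqsubset> p \<and> \<not> p \<sqsubset> q" if "q \<in> Q" for q
        using \<open>Q \<in> M\<close> that notabove notbelow unfolding M_def by blast
      then have "f x \<in> free_colours lt Q f p" using x by (auto simp: free_colours_def)
      then show ?thesis using sub[OF Q(2)] spine_mapD(1)[OF fQ[OF Q(2)] x] by blast
    qed
    then obtain c where c: "\<And>Q. Q \<in> M \<Longrightarrow> c Q \<in> ?H \<and> c Q \<in> Q" by metis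
    have "inj_on c M"
    proof (rule inj_onI)
      fix Q R assume QR: "Q \<in> M" "R \<in> M" "c Q = c R"
      then have "Q \<in> \<Q>" "R \<in> \<Q>" using I(1) by (auto simp: M_def)
      then show "Q = R" using region_disjoint[OF fam] c QR by metis
    qed
    moreover have "c ` M \<subseteq> ?H" using c by blast
    ultimately have "finite M" using fin finite_subset finite_imageD by blast
    define A where "A = {Q \<in> \<I>. \<not> (\<exists>R\<in>\<I>. below lt R Q)}"
    define B where "B = {Q \<in> \<I>. \<not> (\<exists>R\<in>\<I>. below lt Q R)}"
    have single: "finite X" if "\<And>Q R. Q \<in> X \<Longrightarrow> R \<in> X \<Longrightarrow> Q = R" for X :: "'a set set"
    proof (cases "X = {}")
      case False
      then obtain Q where "Q \<in> X" by blast
      then have "X \<subseteq> {Q}" using that by blast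
      then show ?thesis using finite_subset by blast
    qed simp
    have "finite A" by (rule single) (use lin in \<open>auto simp: A_def\<close>)
    moreover have "finite B" by (rule single) (use lin in \<open>auto simp: B_def\<close>)
    moreover have "\<I> \<subseteq> M \<union> A \<union> B" by (auto simp: M_def A_def B_def)
    ultimately show ?thesis using \<open>finite M\<close> by (meson finite_UnI finite_subset)
  qed
  show False
  proof (cases "\<exists>Q1\<in>\<I>. \<exists>Q2\<in>\<I>. below lt Q1 Q2")
    case True
    then obtain Q1 where Q1: "Q1 \<in> \<I>" "\<exists>Q2\<in>\<I>. below lt Q1 Q2" by blast
    define W where "W = {Q \<in> \<I>. below lt Q1 Q}"
    have "finite W" using \<open>finite \<I>\<close> by (simp add: W_def)
    \<comment> \<open>\<open>Q2\<close> is the immediate successor of \<open>Q1\<close> in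
      \<open>\<I>\<close>, found by minimizing the number of predecessors.\<close>
    obtain Q2 where Q2: "Q2 \<in> W"
      and least: "\<And>R. R \<in> W \<Longrightarrow> card {S \<in> W. below lt S Q2} \<le> card {S \<in> W. below lt S R}"
      using ex_has_least_nat[of "\<lambda>Q. Q \<in> W" _ "\<lambda>R. card {S \<in> W. below lt S R}"] Q1(2)
      by (auto simp: W_def)
    have Q2I: "Q2 \<in> \<I>" "below lt Q1 Q2" using Q2 by (auto simp: W_def)
    have min2: "\<not> below lt R Q2" if R: "R \<in> W" for R
    proof
      assume RQ: "below lt R Q2"
      have Rne: "R \<noteq> {}" using D(1) I(1) R by (auto simp: W_def)
      have "{S \<in> W. below lt S R} \<subset> {S \<in> W. below lt S Q2}"
        using RQ R below_trans[OF _ RQ Rne] below_irrefl[OF Rne] by blast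
      then have "card {S \<in> W. below lt S R} < card {S \<in> W. below lt S Q2}"
        using \<open>finite W\<close> by (intro psubset_card_mono) auto
      then show False using least[OF R] by simp
    qed
    have "noasc lt Q1" using a[OF Q1(1)] notbelow[OF Q2I(1) Q1(1) Q2I(2)] by blast
    then have nl: "no_last_below lt\<inverse>\<inverse> \<Q> Q1" using D(7)[OF I(1)[OF Q1(1)]] by blast
    have "noasc lt\<inverse>\<inverse> Q2" using b[OF Q2I(1)] notabove[OF Q1(1) Q2I(1,2)] by blast
    then obtain l where l: "l \<in> Q2" "\<And>y. y \<in> Q2 \<Longrightarrow> \<not> y \<sqsubset> l"
      using nodesc_minimal[of Q2] D(1)[OF I(1)[OF Q2I(1)]] by blast
    \<comment> \<open>Since \<open>l\<close> is minimal in \<open>Q2\<close>, this \<open>R\<close>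
      is strictly between \<open>Q1\<close> and \<open>Q2\<close>; then it belongs to
      \<open>\<I>\<close>, against the choice of \<open>Q2\<close>.\<close>
    have "\<exists>R\<in>\<Q>. below lt Q1 R \<and> (\<exists>l'\<in>R. l' \<sqsubset> l)"
      using nl I(1)[OF Q2I(1)] Q2I(2) l(1) unfolding no_last_below_def by simp
    then obtain R l' where R: "R \<in> \<Q>" "below lt Q1 R" "l' \<in> R" "l' \<sqsubset> l" by blast
    have RQ2: "below lt R Q2"
    proof -
      have "R \<noteq> Q2" using R(3,4) l(2) by blast
      moreover have "\<not> below lt Q2 R" using R(3,4) l(1) asym unfolding below_def by blast
      ultimately show ?thesis using D(4)[OF R(1) I(1)[OF Q2I(1)]] by blast
    qed
    have "\<not> below lt R {p}" using below_trans[OF R(2)] I(2)[OF Q1(1)] R(3) by blast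
    moreover have "\<not> below lt {p} R" using below_trans[OF _ RQ2] I(3)[OF Q2I(1)] R(3) by blast
    ultimately have "R \<in> W" using R(1,2) by (simp add: W_def \<I>_def)
    then show False using min2 RQ2 by blast
  next
    case False
    obtain Q where Q: "Q \<in> \<I>" using comp by (auto simp: \<I>_def)
    note QQ = I(1)[OF Q]
    \<comment> \<open>No other region comparable to \<open>Q\<close> is in \<open>\<I>\<close>, so
      each lies on one side of \<open>p\<close>, and the wrong side would put \<open>Q\<close> on
      one side of \<open>p\<close> as well.\<close>
    have "compat lt \<Q> Q p"
      unfolding compat_def
    proof (intro ballI conjI impI)
      fix R assume R: "R \<in> \<Q>"
      show "below lt R {p}" if "below lt R Q"
      proof (rule ccontr)
        assume n: "\<not> below lt R {p}"
        have "\<not> below lt {p} R" using below_trans[OF _ that] I(3)[OF Q] D(1)[OF R] by blast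
        then show False using n R False that Q by (auto simp: \<I>_def)
      qed
      show "below lt {p} R" if "below lt Q R"
      proof (rule ccontr)
        assume n: "\<not> below lt {p} R"
        have "\<not> below lt R {p}" using below_trans[OF that] I(2)[OF Q] D(1)[OF R] by blast
        then show False using n R False that Q by (auto simp: \<I>_def)
      qed
    qed
    moreover have "p \<notin> Q" using p(2) QQ by blast
    ultimately show False using D(5)[OF QQ p(1)] a[OF Q] b[OF Q] by blast
  qed
qed

lemma spine_map_exists: "\<exists>F. spine_map lt P F"
proof -
  obtain \<Q> where fam: "region_family lt P \<Q>"
    and comp: "\<And>p. p \<in> P \<Longrightarrow> \<exists>R\<in>\<Q>. \<not> below lt R {p} \<and> \<not> below lt {p} R"
    using maximal_region_family by blast
  obtain f where f: "spine_map lt (\<Union>\<Q>) f" "\<And>Q. Q \<in> \<Q> \<Longrightarrow> spine_map lt Q f"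
    using family_spine_map[OF fam] by blast
  let ?U = "\<Union>\<Q>" and ?H = "free_colours lt (\<Union>\<Q>) f"
  have UP: "?U \<subseteq> P" using region_familyD(2)[OF fam] by blast
  define A where "A = P - ?U"
  have cA: "countable A" using countable_carrier by (simp add: A_def)
  have inf: "infinite (?H p)" if "p \<in> A" for p
  proof (rule infinite_free_colours[OF fam])
    show "p \<in> P" "p \<notin> ?U" using that by (simp_all add: A_def)
    then show "\<exists>R\<in>\<Q>. \<not> below lt R {p} \<and> \<not> below lt {p} R" using comp by blast
  qed (fact f)+
  \<comment> \<open>For a finite \<open>A\<close> the enumeration repeats points; this is harmless,
    since every index gets a fresh colour and \<open>g\<close> uses one index per point. The premise
    \<open>A \<noteq> {}\<close> covers the case that nothing is left over.\<close>
  have "\<exists>h. \<forall>n. A \<noteq> {} \<longrightarrow> h n \<in> ?H (from_nat_into A n) \<and> h n \<notin> h ` {..<n}"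
  proof (rule finite_history_choice[where R = "\<lambda>n F x. A \<noteq> {} \<longrightarrow> x \<in> ?H (from_nat_into A n) \<and> x \<notin> F"])
    fix n and F :: "'a set" assume "finite F"
    show "\<exists>x. A \<noteq> {} \<longrightarrow> x \<in> ?H (from_nat_into A n) \<and> x \<notin> F"
    proof (cases "A = {}")
      case False
      have "infinite (?H (from_nat_into A n))" by (rule inf[OF from_nat_into[OF False]])
      then have "\<not> ?H (from_nat_into A n) \<subseteq> F" using finite_subset[OF _ \<open>finite F\<close>] by blast
      then show ?thesis by blast
    qed simp
  qed
  then obtain h where h: "\<And>n. A \<noteq> {} \<Longrightarrow> h n \<in> ?H (from_nat_into A n)"
    "\<And>n. A \<noteq> {} \<Longrightarrow> h n \<notin> h ` {..<n}" by blast
  define g where "g p = h (to_nat_on A p)" for p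
  have gH: "g p \<in> ?H p" if "p \<in> A" for p
    using h(1)[of "to_nat_on A p"] from_nat_into_to_nat_on[OF cA that] that by (auto simp: g_def)
  have g_inj: "p = q" if "p \<in> A" "q \<in> A" "g p = g q" for p q
  proof -
    have ne: "A \<noteq> {}" using that by blast
    have "h m \<noteq> h n" if "m < n" for m n using h(2)[OF ne, of n] that by (metis imageI lessThan_iff)
    then have "to_nat_on A p = to_nat_on A q"
      using that(3) unfolding g_def by (metis linorder_neqE_nat)
    then show ?thesis using that(1,2) cA by simp
  qed
  \<comment> \<open>The values of \<open>g\<close> are existing colours, so the chain stays that of
    \<open>f\<close>, and each class gains at most one outside point.\<close>
  define F where "F p = (if p \<in> ?U then f p else g p)" for p
  have FU: "F x \<in> f ` ?U" if "x \<in> P" for x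
    using that gH by (auto simp: F_def A_def free_colours_def)
  have fU: "c \<in> ?U" "F c = c" if "c \<in> f ` ?U" for c
    using that spine_mapD(1,2)[OF f(1)] by (auto simp: F_def)
  have "spine_map lt P F"
    unfolding spine_map_def
  proof (intro conjI ballI impI)
    fix x assume x: "x \<in> P"
    show "F x \<in> P" "F (F x) = F x" using fU FU[OF x] UP by blast+
    fix y assume y: "y \<in> P"
    show "F x = F y \<or> F x \<sqsubset> F y \<or> F y \<sqsubset> F x"
      using FU[OF x] FU[OF y] spine_mapD(4)[OF f(1)] by (metis imageE)
    show "\<not> x \<sqsubset> y" if eq: "F x = F y"
    proof -
      consider "x \<in> ?U" "y \<in> ?U" | "x \<in> ?U" "y \<in> A" | "x \<in> A" "y \<in> ?U" | "x \<in> A" "y \<in> A"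
        using x y by (auto simp: A_def)
      then show ?thesis
      proof cases
        case 1
        then show ?thesis using spine_mapD(3)[OF f(1) 1] eq by (simp add: F_def)
      next
        case 2
        then have "f x = g y" using eq by (auto simp: F_def A_def)
        then show ?thesis using gH[OF 2(2)] 2(1) unfolding free_colours_def by blast
      next
        case 3
        then have "f y = g x" using eq by (auto simp: F_def A_def)
        then show ?thesis using gH[OF 3(1)] 3(2) unfolding free_colours_def by blast
      next
        case 4
        then have "x = y" using g_inj eq by (auto simp: F_def A_def)
        then show ?thesis using irrefl by simp
      qed
    qed
  qed
  then show ?thesis by blast
qed

end

section \<open>Vacillating posets\<close>

abbreviation strict_of :: "'a rel \<Rightarrow> 'a \<Rightarrow> 'a \<Rightarrow> bool" where
  "strict_of r \<equiv> \<lambda>x y. (x, y) \<in> r - Id"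

lemma strict_of_converse: "strict_of (r\<inverse>) = (strict_of r)\<inverse>\<inverse>"
  by (auto simp: fun_eq_iff)

text \<open>Maximality is sought among the chains that contain a fixed monotone sequence, which
  makes the result infinite.\<close>

lemma (in fac_order) infinite_maximal_chain:
  assumes X: "X \<subseteq> P" "infinite X"
  obtains M where "M \<subseteq> X" "infinite M" "\<forall>x\<in>M. \<forall>y\<in>M. x = y \<or> x \<sqsubset> y \<or> y \<sqsubset> x"
    "\<forall>z\<in>X. (\<forall>t\<in>M. t = z \<or> t \<sqsubset> z \<or> z \<sqsubset> t) \<longrightarrow> z \<in> M"
proof -
  interpret d: fac_order "lt\<inverse>\<inverse>" P by (rule dual)
  obtain f where f: "asc lt X f \<or> asc lt\<inverse>\<inverse> X f" using infinite_asc_or_desc[OF X] by blast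
  define \<C> where "\<C> = {S. range f \<subseteq> S \<and> S \<subseteq> X \<and> (\<forall>x\<in>S. \<forall>y\<in>S. x = y \<or> x \<sqsubset> y \<or> y \<sqsubset> x)}"
  have cmp: "f i \<sqsubset> f j \<or> f j \<sqsubset> f i" if "i < j" for i j
    using f asc_less[OF _ that] d.asc_less[OF _ that] by fastforce
  have "\<exists>M\<in>\<C>. \<forall>S\<in>\<C>. M \<subseteq> S \<longrightarrow> S = M"
  proof (rule subset_Zorn_nonempty)
    have "f i = f j \<or> f i \<sqsubset> f j \<or> f j \<sqsubset> f i" for i j
      using cmp[of i j] cmp[of j i] by (cases i j rule: linorder_cases) auto
    then have "range f \<in> \<C>" using f by (auto simp: \<C>_def asc_def)
    then show "\<C> \<noteq> {}" by blast
    fix \<D> assume D: "\<D> \<noteq> {}" "subset.chain \<C> \<D>"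
    have sub: "\<D> \<subseteq> \<C>" using D(2) by (simp add: subset_chain_def)
    have "x = y \<or> x \<sqsubset> y \<or> y \<sqsubset> x" if xy: "x \<in> \<Union>\<D>" "y \<in> \<Union>\<D>" for x y
    proof -
      obtain Y Z where YZ: "Y \<in> \<D>" "Z \<in> \<D>" "x \<in> Y" "y \<in> Z" using xy by blast
      then have "Y \<subseteq> Z \<or> Z \<subseteq> Y" using D(2) by (auto simp: subset_chain_def)
      then obtain S where "S \<in> \<D>" "x \<in> S" "y \<in> S" using YZ by blast
      then show ?thesis using sub by (auto simp: \<C>_def)
    qed
    moreover have "range f \<subseteq> \<Union>\<D>" "\<Union>\<D> \<subseteq> X" using D(1) sub unfolding \<C>_def by blast+
    ultimately show "\<Union>\<D> \<in> \<C>" by (simp add: \<C>_def)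
  qed
  then obtain M where M: "M \<in> \<C>" and mx: "\<And>S. S \<in> \<C> \<Longrightarrow> M \<subseteq> S \<Longrightarrow> S = M" by blast
  have "z \<in> M" if z: "z \<in> X" "\<forall>t\<in>M. t = z \<or> t \<sqsubset> z \<or> z \<sqsubset> t" for z
  proof -
    have "insert z M \<in> \<C>" using M z by (auto simp: \<C>_def)
    then show ?thesis using mx by blast
  qed
  moreover have "infinite (range f)"
    using f asc_infinite[of "range f" f] d.asc_infinite[of "range f" f] by (auto simp: asc_def)
  then have "infinite M" using M finite_subset by (auto simp: \<C>_def)
  ultimately show ?thesis using M by (intro that[of M]) (auto simp: \<C>_def)
qed

text \<open>Each interval of the sequence is filled with a maximal infinite chain; maximality inside
  the intervals gives contiguity of the union.\<close>

lemma bad_seq_contiguous_sum: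
  assumes po: "partial_order_on P r" and fo: "fac_order (strict_of r) P"
    and bad: "\<not> no_bad_seq (strict_of r)"
  shows "\<exists>C. contiguous_chain P r C \<and> omega_sum_of_infinite_co_wellfounded C r"
proof -
  let ?lt = "strict_of r"
  interpret fac_order ?lt P by (rule fo)
  obtain x :: "nat \<Rightarrow> 'a" where x: "\<And>i. ?lt (x i) (x (Suc i))"
    "\<And>i. infinite (oi ?lt (x i) (x (Suc i)))" "\<And>i. noasc ?lt (oi ?lt (x i) (x (Suc i)))"
    using bad unfolding no_bad_seq_def by blast
  have xasc: "asc ?lt P x" using x(1) field by (auto simp: asc_def)
  have "\<exists>M\<subseteq>oi ?lt (x i) (x (Suc i)). infinite M \<and> (\<forall>a\<in>M. \<forall>b\<in>M. a = b \<or> ?lt a b \<or> ?lt b a) \<and>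
      (\<forall>z\<in>oi ?lt (x i) (x (Suc i)). (\<forall>t\<in>M. t = z \<or> ?lt t z \<or> ?lt z t) \<longrightarrow> z \<in> M)" for i
  proof -
    have "oi ?lt (x i) (x (Suc i)) \<subseteq> P" using field by (auto simp: oi_def)
    from this x(2) show ?thesis by (rule infinite_maximal_chain) blast
  qed
  then obtain M where M: "\<And>i. M i \<subseteq> oi ?lt (x i) (x (Suc i))" "\<And>i. infinite (M i)"
    "\<And>i. \<forall>a\<in>M i. \<forall>b\<in>M i. a = b \<or> ?lt a b \<or> ?lt b a"
    "\<And>i. \<forall>z\<in>oi ?lt (x i) (x (Suc i)). (\<forall>t\<in>M i. t = z \<or> ?lt t z \<or> ?lt z t) \<longrightarrow> z \<in> M i"
    by metis
  \<comment> \<open>The points \<open>x i\<close> belong to the chain, so that any point to be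
    inserted is comparable to all of them and falls into a single interval.\<close>
  define S where "S i = insert (x i) (M i)" for i
  define C where "C = (\<Union>i. S i)"
  have S_lo: "a = x i \<or> ?lt (x i) a" if "a \<in> S i" for a i
    using that M(1)[of i] by (auto simp: S_def oi_def)
  have S_hi: "?lt a (x (Suc i))" if "a \<in> S i" for a i
    using that M(1)[of i] x(1)[of i] by (auto simp: S_def oi_def)
  have S_less: "?lt a b" if "a \<in> S i" "b \<in> S j" "i < j" for a b i j
  proof -
    have "x (Suc i) = x j \<or> ?lt (x (Suc i)) (x j)"
      using asc_less[OF xasc, of "Suc i" j] that(3) by (cases "Suc i = j") auto
    then have "?lt a (x j)" using S_hi[OF that(1)] trans by metis
    then show ?thesis using S_lo[OF that(2)] trans by metis
  qed
  have S_chain: "a = b \<or> ?lt a b \<or> ?lt b a" if "a \<in> S i" "b \<in> S i" for a b i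
    using that M(1)[of i] M(3)[of i] by (auto simp: S_def oi_def)
  have CP: "C \<subseteq> P" using S_hi field unfolding C_def by blast
  have refl: "(a, a) \<in> r" if "a \<in> C" for a
    using po CP that by (auto simp: partial_order_on_def preorder_on_def refl_on_def)
  have anti: "a = b" if "(a, b) \<in> r" "(b, a) \<in> r" for a b
    using po that by (auto simp: partial_order_on_def antisym_def)
  have C_chain: "a = b \<or> ?lt a b \<or> ?lt b a" if ab: "a \<in> C" "b \<in> C" for a b
  proof -
    obtain i j where "a \<in> S i" "b \<in> S j" using ab by (auto simp: C_def)
    then show ?thesis using S_chain S_less by (cases i j rule: linorder_cases) blast+
  qed
  have "contiguous_chain P r C"
    unfolding contiguous_chain_def
  proof (intro conjI notI)
    show "poset_chain P r C"
      using CP C_chain unfolding poset_chain_def total_on_def by fast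
    assume "\<exists>z\<in>P - C. \<exists>y\<in>C. \<exists>w\<in>C. (y, z) \<in> r - Id \<and> (z, w) \<in> r - Id \<and> poset_chain P r (C \<union> {z})"
    then obtain z y w where z: "z \<notin> C" and yw: "y \<in> C" "w \<in> C" "?lt y z" "?lt z w"
      and ch: "poset_chain P r (C \<union> {z})" by blast
    have cmp: "?lt t z \<or> ?lt z t" if "t \<in> C" for t
    proof -
      have "t \<noteq> z" using that z by blast
      moreover have "total_on (C \<union> {z}) r" using ch by (simp add: poset_chain_def)
      then have "t \<noteq> z \<Longrightarrow> (t, z) \<in> r \<or> (z, t) \<in> r" using that by (simp add: total_on_def)
      ultimately show ?thesis by auto
    qed
    have xC: "x k \<in> C" for k by (auto simp: C_def S_def)
    obtain j where "w \<in> S j" using yw(2) by (auto simp: C_def)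
    then have "?lt z (x (Suc j))" using S_hi yw(4) trans by blast
    then have ex: "\<exists>n. ?lt z (x n)" by blast
    \<comment> \<open>\<open>n\<close> is not 0 because \<open>x 0\<close> is the least element of
      \<open>C\<close>; so \<open>z\<close> lies between two consecutive points of the
      sequence.\<close>
    define n where "n = (LEAST n. ?lt z (x n))"
    have n: "?lt z (x n)" using LeastI_ex[OF ex] by (simp add: n_def)
    obtain i where "y \<in> S i" using yw(1) by (auto simp: C_def)
    then have "?lt (x i) z" using S_lo yw(3) trans by metis
    then have "n \<noteq> 0"
      using n asc_less[OF xasc, of 0 i] trans irrefl by (metis gr0I)
    then obtain k where k: "n = Suc k" using not0_implies_Suc by blast
    have "\<not> ?lt z (x k)" using not_less_Least[of k "\<lambda>n. ?lt z (x n)"] k by (simp add: n_def)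
    then have "?lt (x k) z" using cmp[OF xC] by blast
    then have "z \<in> oi ?lt (x k) (x (Suc k))" using n k by (simp add: oi_def)
    moreover have "t = z \<or> ?lt t z \<or> ?lt z t" if "t \<in> M k" for t
      using cmp[of t] that by (auto simp: C_def S_def)
    ultimately have "z \<in> M k" using M(4)[of k] by blast
    then show False using z by (auto simp: C_def S_def)
  qed
  moreover have "omega_sum_of_infinite_co_wellfounded C r"
    unfolding omega_sum_of_infinite_co_wellfounded_def
  proof (intro exI[of _ S] conjI allI)
    show "infinite (S i)" for i using M(2) by (simp add: S_def)
    show "co_wellfounded (S i) r" for i
      unfolding co_wellfounded_def
    proof
      assume "\<exists>f :: nat \<Rightarrow> 'a. range f \<subseteq> S i \<and> (\<forall>m n. m < n \<longrightarrow> (f m, f n) \<in> r - Id)"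
      then obtain f :: "nat \<Rightarrow> 'a" where f: "range f \<subseteq> S i" "\<And>m n. m < n \<Longrightarrow> ?lt (f m) (f n)" by blast
      \<comment> \<open>The term \<open>f 0\<close> is dropped, as it may be \<open>x i\<close>
        itself, which is outside the open interval.\<close>
      have "?lt (x i) (f (Suc n))" for n
        using S_lo[of "f 0" i] f(1) f(2)[of 0 "Suc n"] trans by (metis rangeI subsetD zero_less_Suc)
      moreover have "?lt (f (Suc n)) (x (Suc i))" for n using S_hi f(1) by blast
      ultimately have "asc ?lt (oi ?lt (x i) (x (Suc i))) (\<lambda>n. f (Suc n))"
        using f(2) by (auto simp: asc_def oi_def)
      then show False using x(3) unfolding noasc_def by blast
    qed
    show "is_linear_sum C r UNIV S"
      unfolding is_linear_sum_def
    proof (intro conjI)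
      show "disjoint_family_on S UNIV"
        unfolding disjoint_family_on_def
        using S_less irrefl by (metis disjoint_iff linorder_neqE_nat)
      show "C = (\<Union>i\<in>UNIV. S i)" by (simp add: C_def)
      show "Restr r C = (\<Union>i\<in>UNIV. Restr r (S i)) \<union> (\<Union>i\<in>UNIV. \<Union>j\<in>{j \<in> UNIV. i < j}. S i \<times> S j)"
      proof (intro equalityI subsetI)
        fix ab assume ab: "ab \<in> Restr r C"
        then obtain a b i j where ij: "ab = (a, b)" "(a, b) \<in> r" "a \<in> S i" "b \<in> S j"
          by (auto simp: C_def)
        have "\<not> j < i" using S_less[OF ij(4,3)] anti ij(2) by blast
        then show "ab \<in> (\<Union>i\<in>UNIV. Restr r (S i)) \<union> (\<Union>i\<in>UNIV. \<Union>j\<in>{j \<in> UNIV. i < j}. S i \<times> S j)"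
          using ij by (cases "i = j") auto
      next
        fix ab assume "ab \<in> (\<Union>i\<in>UNIV. Restr r (S i)) \<union> (\<Union>i\<in>UNIV. \<Union>j\<in>{j \<in> UNIV. i < j}. S i \<times> S j)"
        then show "ab \<in> Restr r C"
        proof
          assume "ab \<in> (\<Union>i\<in>UNIV. Restr r (S i))"
          then show ?thesis by (auto simp: C_def)
        next
          assume "ab \<in> (\<Union>i\<in>UNIV. \<Union>j\<in>{j \<in> UNIV. i < j}. S i \<times> S j)"
          then obtain a b i j where "ab = (a, b)" "a \<in> S i" "b \<in> S j" "i < j" by auto
          then show ?thesis using S_less[of a i b j] by (auto simp: C_def)
        qed
      qed
    qed
  qed
  ultimately show ?thesis by blast
qed

lemma contiguous_chain_converse: "contiguous_chain P (r\<inverse>) C = contiguous_chain P r C"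
proof -
  have "contiguous_chain P (r\<inverse>) C" if "contiguous_chain P r C" for r :: "'a rel"
    using that unfolding contiguous_chain_def poset_chain_def by auto
  from this[of r] this[of "r\<inverse>"] show ?thesis by auto
qed

theorem mainTheorem2:
  fixes P :: "'a set" and r :: "'a rel"
  assumes "partial_order_on P r"
    and "countable P"
    and "\<not> (\<exists>A. poset_antichain P r A \<and> infinite A)"
    and "vacillating P r"
  shows "\<exists>C. spine P r C"
proof -
  let ?lt = "strict_of r"
  have rP: "r \<subseteq> P \<times> P" and tr: "trans r" and anti: "antisym r"
    using assms(1) by (auto simp: partial_order_on_def preorder_on_def)
  have fo: "fac_order ?lt P"
  proof
    show "?lt x z" if "?lt x y" "?lt y z" for x y z
      using that tr anti by (auto dest: transD antisymD)
    show "\<exists>x\<in>A. \<exists>y\<in>A. ?lt x y" if A: "A \<subseteq> P" "infinite A" for A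
    proof (rule ccontr)
      assume "\<not> ?thesis"
      then have "poset_antichain P r A" using A(1) unfolding poset_antichain_def by fastforce
      then show False using assms(3) A(2) by blast
    qed
  qed (use rP assms(2) in auto)
  then have fo': "fac_order (strict_of (r\<inverse>)) P"
    unfolding strict_of_converse by (rule fac_order.dual)
  have po': "partial_order_on P (r\<inverse>)" using assms(1) by simp
  have "no_bad_seq ?lt"
  proof (rule ccontr)
    assume "\<not> no_bad_seq ?lt"
    from bad_seq_contiguous_sum[OF assms(1) fo this] show False
      using assms(4) unfolding vacillating_def by blast
  qed
  moreover have "no_bad_seq (strict_of (r\<inverse>))"
  proof (rule ccontr)
    assume "\<not> no_bad_seq (strict_of (r\<inverse>))"
    from bad_seq_contiguous_sum[OF po' fo' this] show False
      using assms(4) unfolding vacillating_def contiguous_chain_converse by blast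
  qed
  then have "no_bad_seq ?lt\<inverse>\<inverse>" unfolding strict_of_converse .
  ultimately interpret vac_order ?lt P
    using fo by (simp add: vac_order_def vac_order_axioms_def)
  obtain F where F: "spine_map ?lt P F" using spine_map_exists by blast
  note FD = spine_mapD[OF F]
  have "spine P r (F ` P)"
    unfolding spine_def
  proof (intro conjI exI ballI)
    show "poset_chain P r (F ` P)"
      using FD(1,4) unfolding poset_chain_def total_on_def by blast
    let ?A = "\<lambda>c. {x \<in> P. F x = c}"
    show "partition_on P (?A ` (F ` P))"
      by (rule partition_onI) (auto simp: disjnt_def)
    fix X assume "X \<in> ?A ` (F ` P)"
    then obtain c where c: "c \<in> F ` P" "X = ?A c" by blast
    have "\<not> ?lt x y" if "x \<in> X" "y \<in> X" for x y
      using FD(3) that c(2) by auto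
    then show "poset_antichain P r X"
      using c(2) unfolding poset_antichain_def by blast
    have "c \<in> X" using c FD(1,2) by auto
    then show "X \<inter> F ` P \<noteq> {}" using c(1) by blast
  qed
  then show ?thesis by blast
qed

end
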